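(* Let $F$ satisfy the structural hypotheses (i)–(iv) of the context with $\alpha\ge 0$, and let $f$ be continuous on $I$. Suppose that $N\le 3$, or, when $N>3$, that the maps $M\mapsto F(x,p,M)$ ($x\in\Omega$, $p\neq 0$) are all convex or all concave. Suppose that $u$ is a (continuous) radial viscosity solution of $F(x,\nabla u,D^2u)=f(|x|)$ in $\Omega$. Then $u$ is of class $\mathcal{C}^{1,\frac{1}{1+\alpha}}$ everywhere, and $u$ is of class $\mathcal{C}^2$ at points where the derivative $u'$ is different from zero.
   Context: Setting. $\Omega\subset\mathbb{R}^N$ is a ball $B(0,R)$ or an annulus $\{R_1<|x|<R_2\}$; correspondingly $I=[0,R)$ or $I=(R_1,R_2)$. $S$ is the space of $N\times N$ symmetric real matrices. $F:\Omega\times(\mathbb{R}^N\setminus\{0\})\times S\to\mathbb{R}$ is continuous and satisfies, for some real $\alpha\ge 0$ and constants $a,A>0$: (i) $F(x,tp,\mu M)=|t|^\alpha\mu F(x,p,M)$ for all $x\in\Omega$, $p\ne0$, $M\in S$, $t\in\mathbb{R}\setminus\{0\}$, $\mu>0$; (ii) $a|p|^\alpha\,\mathrm{tr}(Q)\le F(x,p,M+Q)-F(x,p,M)\le A|p|^\alpha\,\mathrm{tr}(Q)$ for all $x\in\Omega$, $p\neq0$, $M\in S$ and $Q\in S$ with $Q\ge0$; (iii) $F({}^tOx,{}^tOp,{}^tOMO)=F(x,p,M)$ for every orthogonal matrix $O$ and all $x\in\Omega$, $p\ne0$, $M\in S$; (iv) there are $\nu>0$ and $\kappa\in(1/2,1]$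 such that $|F(x,p+q,M)-F(x,p,M)|\le\nu|q|^\kappa|M|$ for all $x\in\Omega$, $|p|=1$, $|q|\le\frac12$, $M\in S$. Viscosity solutions. A continuous function $v$ on $\Omega$ is a viscosity super-solution (resp. sub-solution) of $F(x,\nabla v,D^2v)=f(|x|)$ if for every $x_0\in\Omega$: either there is an open ball $B(x_0,\delta)\subset\Omega$, $\delta>0$, on which $v$ is constant and $0\le f(|x|)$ (resp. $0\ge f(|x|)$) for all $x\in B(x_0,\delta)$; or, for every $\varphi\in\mathcal{C}^2(\Omega)$ such that $v-\varphi$ has a local minimum (resp. local maximum) at $x_0$ and $\nabla\varphi(x_0)\ne0$, one has $F(x_0,\nabla\varphi(x_0),D^2\varphi(x_0))\le f(|x_0|)$ (resp. $\ge f(|x_0|)$). A viscosity solution is both a super- and a sub-solution. A radial function $u$ on $\Omega$ is identified with a function $u(r)$, $r=|x|\in I$, and $u'$ denotes the derivative in $r$ (one-sided at $r=0$). "Of class $\mathcal{C}^{1,\beta}$ everywhere" means: $u$ is $\mathcal{C}^1$ on $I$ and every point of $I$ has a neighbourhood in $I$ on which $u'$ is Hölder continuous with exponent $\beta$. "Of class $\mathcal{C}^2$ at a point" means on a neighbourhood of that point. *)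

theory Defs
  imports "HOL-Analysis.Analysis"
begin

text \<open>A ball with \<open>I = [0, R)\<close>, or an annulus with \<open>I = (R\<^sub>1, R\<^sub>2)\<close>. The inner radius of
  the annulus may be zero (punctured ball).\<close>

definition radial_domain :: "(real^'n) set \<Rightarrow> real set \<Rightarrow> bool" where
  "radial_domain \<Omega> I \<longleftrightarrow>
     (\<exists>R>0. \<Omega> = ball 0 R \<and> I = {0..<R}) \<or>
     (\<exists>R1 R2. 0 \<le> R1 \<and> R1 < R2 \<and> \<Omega> = {x. R1 < norm x \<and> norm x < R2} \<and> I = {R1<..<R2})"

definition sym_matrices :: "(real^'n^'n) set" where
  "sym_matrices = {M. transpose M = M}"

definition psd :: "real^'n^'n \<Rightarrow> bool" where
  "psd Q \<longleftrightarrow> (\<forall>\<xi>. 0 \<le> \<xi> \<bullet> (Q *v \<xi>))"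

text \<open>\<open>\<phi>\<close> is of class \<open>C\<^sup>2\<close> on the open set \<open>\<Omega>\<close>, with gradient field \<open>g\<close> and Hessian field \<open>H\<close>;
  both are then uniquely determined on \<open>\<Omega>\<close>.\<close>

definition C2_grad_hess ::
  "(real^'n) set \<Rightarrow> (real^'n \<Rightarrow> real) \<Rightarrow> (real^'n \<Rightarrow> real^'n) \<Rightarrow> (real^'n \<Rightarrow> real^'n^'n) \<Rightarrow> bool" where
  "C2_grad_hess \<Omega> \<phi> g H \<longleftrightarrow>
     (\<forall>x\<in>\<Omega>. (\<phi> has_derivative (\<lambda>h. g x \<bullet> h)) (at x)) \<and>
     (\<forall>x\<in>\<Omega>. (g has_derivative (\<lambda>h. H x *v h)) (at x)) \<and>
     continuous_on \<Omega> H"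

definition viscosity_supersolution ::
  "(real^'n) set \<Rightarrow> (real^'n \<Rightarrow> real^'n \<Rightarrow> real^'n^'n \<Rightarrow> real) \<Rightarrow> (real \<Rightarrow> real) \<Rightarrow> (real^'n \<Rightarrow> real) \<Rightarrow> bool"
  where
  "viscosity_supersolution \<Omega> F f v \<longleftrightarrow> continuous_on \<Omega> v \<and>
     (\<forall>x0\<in>\<Omega>.
        (\<exists>\<delta>>0. ball x0 \<delta> \<subseteq> \<Omega> \<and> v constant_on ball x0 \<delta> \<and> (\<forall>x\<in>ball x0 \<delta>. 0 \<le> f (norm x))) \<or>
        (\<forall>\<phi> g H. C2_grad_hess \<Omega> \<phi> g H \<longrightarrow>
           (\<forall>\<^sub>F x in nhds x0. v x0 - \<phi> x0 \<le> v x - \<phi> x) \<longrightarrow> g x0 \<noteq> 0 \<longrightarrow>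
           F x0 (g x0) (H x0) \<le> f (norm x0)))"

definition viscosity_subsolution ::
  "(real^'n) set \<Rightarrow> (real^'n \<Rightarrow> real^'n \<Rightarrow> real^'n^'n \<Rightarrow> real) \<Rightarrow> (real \<Rightarrow> real) \<Rightarrow> (real^'n \<Rightarrow> real) \<Rightarrow> bool"
  where
  "viscosity_subsolution \<Omega> F f v \<longleftrightarrow> continuous_on \<Omega> v \<and>
     (\<forall>x0\<in>\<Omega>.
        (\<exists>\<delta>>0. ball x0 \<delta> \<subseteq> \<Omega> \<and> v constant_on ball x0 \<delta> \<and> (\<forall>x\<in>ball x0 \<delta>. 0 \<ge> f (norm x))) \<or>
        (\<forall>\<phi> g H. C2_grad_hess \<Omega> \<phi> g H \<longrightarrow>
           (\<forall>\<^sub>F x in nhds x0. v x - \<phi> x \<le> v x0 - \<phi> x0) \<longrightarrow> g x0 \<noteq> 0 \<longrightarrow>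
           F x0 (g x0) (H x0) \<ge> f (norm x0)))"

definition viscosity_solution ::
  "(real^'n) set \<Rightarrow> (real^'n \<Rightarrow> real^'n \<Rightarrow> real^'n^'n \<Rightarrow> real) \<Rightarrow> (real \<Rightarrow> real) \<Rightarrow> (real^'n \<Rightarrow> real) \<Rightarrow> bool"
  where
  "viscosity_solution \<Omega> F f v \<longleftrightarrow>
     viscosity_supersolution \<Omega> F f v \<and> viscosity_subsolution \<Omega> F f v"

text \<open>\<open>u\<close> is of class \<open>C\<^sup>1\<close> on the interval \<open>J\<close> with derivative \<open>u'\<close>, one-sided at endpoints in \<open>J\<close>.\<close>

definition C1_deriv_on :: "real set \<Rightarrow> (real \<Rightarrow> real) \<Rightarrow> (real \<Rightarrow> real) \<Rightarrow> bool" where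
  "C1_deriv_on J u u' \<longleftrightarrow>
     (\<forall>r\<in>J. (u has_real_derivative u' r) (at r within J)) \<and> continuous_on J u'"

definition locally_holder_on :: "real \<Rightarrow> real set \<Rightarrow> (real \<Rightarrow> real) \<Rightarrow> bool" where
  "locally_holder_on \<beta> J w \<longleftrightarrow>
     (\<forall>r\<in>J. \<exists>\<epsilon>>0. \<exists>C. \<forall>s\<in>J \<inter> ball r \<epsilon>. \<forall>t\<in>J \<inter> ball r \<epsilon>. \<bar>w s - w t\<bar> \<le> C * \<bar>s - t\<bar> powr \<beta>)"

definition C2_at_in :: "real set \<Rightarrow> (real \<Rightarrow> real) \<Rightarrow> real \<Rightarrow> bool" where
  "C2_at_in J u r \<longleftrightarrow>
     (\<exists>\<epsilon>>0. \<exists>u1 u2. C1_deriv_on (J \<inter> ball r \<epsilon>) u u1 \<and> C1_deriv_on (J \<inter> ball r \<epsilon>) u1 u2)"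

end

theory Submission
  imports Defs
begin

text \<open>
  Along a fixed ray, a radial solution satisfies an ordinary differential equation
  \<open>\<bar>u'\<bar> powr \<alpha> * G r u'' (u' / r) = f r\<close> in the viscosity sense, where \<open>G\<close> is continuous, strictly increasing
  in its second argument and of linear growth. The inequalities are available only for test functions with
  nonzero slope \<open>b\<close>. Solving for the second derivative gives \<open>d = curv r b\<close> with \<open>curv\<close> continuous
  for \<open>b \<noteq> 0\<close> and bounded, locally in \<open>r > 0\<close>, by a multiple of \<open>\<bar>b\<bar> + \<bar>b\<bar> powr (- \<alpha>)\<close>.

  The solution is \<open>C\<^sup>1\<close> at positive radii by a comparison with barriers. If two adjacent secants of \<open>u\<close> had too different
  slopes, a function with slopes between them and a curvature that the equation forbids would touch
  \<open>u\<close> (\<open>secant_level_bound\<close>). The barriers can be chosen without critical points, so the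
  restriction on the test functions does no harm. The resulting estimate, in a coordinate for
  slopes that is adapted to the bound on \<open>curv\<close>, makes the difference quotients converge to a continuous derivative.
  Where \<open>u' \<noteq> 0\<close>, comparison with parabolas shows that \<open>u'' = curv r u'\<close> holds classically, and the right-hand side is
  continuous. Consequently \<open>\<bar>u'\<bar> powr \<alpha> * u'\<close> has a locally bounded derivative off its zeros; it is thus locally
  Lipschitz, and \<open>u'\<close> is Hoelder continuous with exponent \<open>1 / (1 + \<alpha>)\<close>.

  At the centre of a ball, the function \<open>v\<close> cannot lie above an upward cone, because under such a cone
  there are test functions of arbitrarily large curvature (\<open>supersolution_no_cone\<close>); by duality it cannot lie
  below a downward cone. Hence \<open>\<bar>u'\<bar>\<close> takes arbitrarily small
  values near \<open>0\<close>. Since the term \<open>u' / r\<close> never helps \<open>\<bar>u'\<bar>\<close> to grow, integrating the equation yields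
  \<open>\<bar>u'\<bar> powr (1 + \<alpha>) \<le> L * r\<close>, which controls \<open>u' / r\<close> well enough to make the Hoelder estimate uniform up to \<open>r = 0\<close>.
\<close>

section \<open>Signed powers and the level of a slope\<close>

definition signed_powr :: "real \<Rightarrow> real \<Rightarrow> real" where
  "signed_powr \<gamma> x = sgn x * \<bar>x\<bar> powr \<gamma>"

lemma signed_powr_minus [simp]: "signed_powr \<gamma> (- x) = - signed_powr \<gamma> x" by (simp add: signed_powr_def)
lemma sgn_signed_powr [simp]: "sgn (signed_powr \<gamma> x) = sgn x"
  by (simp add: signed_powr_def sgn_mult) (simp add: sgn_if)
lemma abs_signed_powr: "\<bar>signed_powr \<gamma> x\<bar> = \<bar>x\<bar> powr \<gamma>"
  by (simp add: signed_powr_def abs_mult)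
lemma signed_powr_eq_0_iff [simp]: "signed_powr \<gamma> x = 0 \<longleftrightarrow> x = 0"
  by (simp add: signed_powr_def sgn_if)

lemma signed_powr_signed_powr: "signed_powr \<gamma> (signed_powr \<delta> x) = signed_powr (\<delta> * \<gamma>) x"
  unfolding signed_powr_def[of \<gamma> "signed_powr \<delta> x"] abs_signed_powr sgn_signed_powr by (simp add: signed_powr_def powr_powr)

lemma signed_powr_1 [simp]: "signed_powr 1 x = x"
  by (simp add: signed_powr_def sgn_mult_abs)

lemma signed_powr_max: "signed_powr \<gamma> x = max x 0 powr \<gamma> - max (- x) 0 powr \<gamma>"
  by (auto simp: signed_powr_def sgn_if max_def)

lemma continuous_on_signed_powr [continuous_intros]:
  assumes "\<gamma> > 0" "continuous_on A h"
  shows "continuous_on A (\<lambda>x. signed_powr \<gamma> (h x))"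
  unfolding signed_powr_max using assms
  by (intro continuous_intros continuous_on_powr') (auto)

lemma strict_mono_signed_powr: "\<gamma> > 0 \<Longrightarrow> strict_mono (signed_powr \<gamma>)"
proof (rule strict_monoI)
  fix x y :: real assume "\<gamma> > 0" "x < y"
  have 1: "max x 0 powr \<gamma> \<le> max y 0 powr \<gamma>" "max (- y) 0 powr \<gamma> \<le> max (- x) 0 powr \<gamma>"
    using \<open>\<gamma> > 0\<close> \<open>x < y\<close> by (intro powr_mono2; simp)+
  have "max x 0 powr \<gamma> < max y 0 powr \<gamma> \<or> max (- y) 0 powr \<gamma> < max (- x) 0 powr \<gamma>"
    using \<open>\<gamma> > 0\<close> \<open>x < y\<close> by (cases "y > 0") (auto intro!: powr_less_mono2)
  with 1 show "signed_powr \<gamma> x < signed_powr \<gamma> y" unfolding signed_powr_max by linarith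
qed

lemma has_real_derivative_signed_powr:
  assumes "x \<noteq> 0"
  shows "(signed_powr \<gamma> has_real_derivative \<gamma> * \<bar>x\<bar> powr (\<gamma> - 1)) (at x)"
proof (cases "x > 0")
  case True
  have "((\<lambda>x. x powr \<gamma>) has_real_derivative \<gamma> * \<bar>x\<bar> powr (\<gamma> - 1)) (at x)"
    using True by (auto intro!: derivative_eq_intros)
  then show ?thesis
    by (rule has_field_derivative_transform_within_open[where S="{0<..}"]) (use True in \<open>auto simp: signed_powr_def\<close>)
next
  case False
  have "((\<lambda>x. - ((- x) powr \<gamma>)) has_real_derivative \<gamma> * \<bar>x\<bar> powr (\<gamma> - 1)) (at x)"
    using False assms by (auto intro!: derivative_eq_intros)
  then show ?thesis
    by (rule has_field_derivative_transform_within_open[where S="{..<0}"]) (use False assms in \<open>auto simp: signed_powr_def\<close>)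
qed

lemma powr_diff_le:
  fixes x y :: real
  assumes "0 < \<beta>" "\<beta> \<le> 1" "0 \<le> y" "y \<le> x"
  shows "x powr \<beta> - y powr \<beta> \<le> (x - y) powr \<beta>"
proof (cases "x = 0")
  case False
  then have x: "x > 0" using assms by simp
  have *: "t \<le> t powr \<beta>" if "0 \<le> t" "t \<le> 1" for t :: real
    using powr_mono'[of \<beta> 1 t] that assms by simp
  have "1 \<le> ((x - y)/x) powr \<beta> + (y / x) powr \<beta>"
  proof -
    have "1 = (x - y)/x + y/x" using x by (simp add: field_simps)
    also have "\<dots> \<le> ((x - y)/x) powr \<beta> + (y / x) powr \<beta>"
      using x assms by (intro add_mono *) (auto simp: field_simps)
    finally show ?thesis .
  qed
  then have "1 \<le> (x - y) powr \<beta> / x powr \<beta> + y powr \<beta> / x powr \<beta>"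
    using x assms by (simp add: powr_divide)
  moreover have "x powr \<beta> > 0" using x by simp
  ultimately show ?thesis by (simp add: field_simps)
qed (use assms in auto)

lemma signed_powr_holder:
  assumes "0 < \<beta>" "\<beta> \<le> 1"
  shows "\<bar>signed_powr \<beta> x - signed_powr \<beta> y\<bar> \<le> 2 * \<bar>x - y\<bar> powr \<beta>"
proof -
  have 1: "\<bar>max x 0 powr \<beta> - max y 0 powr \<beta>\<bar> \<le> \<bar>x - y\<bar> powr \<beta>" for x y :: real
  proof -
    have "max x 0 powr \<beta> - max y 0 powr \<beta> \<le> \<bar>x - y\<bar> powr \<beta>" if "y \<le> x" for x y :: real
    proof -
      have "max x 0 powr \<beta> - max y 0 powr \<beta> \<le> (max x 0 - max y 0) powr \<beta>"
        using assms that by (intro powr_diff_le) auto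
      also have "\<dots> \<le> \<bar>x - y\<bar> powr \<beta>"
        using assms that by (intro powr_mono2) auto
      finally show ?thesis .
    qed
    moreover have "max y 0 powr \<beta> \<le> max x 0 powr \<beta>" if "y \<le> x" for x y :: real
      using assms that by (intro powr_mono2) auto
    ultimately show ?thesis
      by (smt (verit) abs_minus_commute)
  qed
  have tri: "\<bar>a - b - (c - d)\<bar> \<le> \<bar>a - c\<bar> + \<bar>b - d\<bar>" for a b c d :: real
    by linarith
  have "\<bar>- x - - y\<bar> = \<bar>x - y\<bar>" by simp
  then have "\<bar>max x 0 powr \<beta> - max y 0 powr \<beta>\<bar> + \<bar>max (- x) 0 powr \<beta> - max (- y) 0 powr \<beta>\<bar>
      \<le> \<bar>x - y\<bar> powr \<beta> + \<bar>x - y\<bar> powr \<beta>"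
    using 1[of x y] 1[of "- x" "- y"] by (intro add_mono) simp_all
  then show ?thesis unfolding signed_powr_max by (intro order.trans[OF tri]) simp
qed

definition signed_log :: "real \<Rightarrow> real" where "signed_log x = sgn x * ln (1 + \<bar>x\<bar>)"
definition signed_exp :: "real \<Rightarrow> real" where "signed_exp y = sgn y * (exp \<bar>y\<bar> - 1)"

lemma sgn_signed_exp [simp]: "sgn (signed_exp y) = sgn y"
  by (auto simp: signed_exp_def sgn_if)
lemma abs_signed_exp: "\<bar>signed_exp y\<bar> = exp \<bar>y\<bar> - 1"
  by (auto simp: signed_exp_def sgn_if)
lemma signed_exp_signed_log [simp]: "signed_exp (signed_log x) = x"
  by (auto simp: signed_exp_def signed_log_def sgn_if)
lemma signed_log_minus [simp]: "signed_log (- x) = - signed_log x" by (simp add: signed_log_def)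

lemma signed_exp_max: "signed_exp y = exp (max y 0) - exp (max (- y) 0)"
  by (auto simp: signed_exp_def sgn_if max_def)

lemma continuous_on_signed_exp: "continuous_on A signed_exp"
  unfolding signed_exp_max by (intro continuous_intros)

lemma strict_mono_signed_exp: "strict_mono signed_exp"
  by (rule strict_monoI) (smt (verit) exp_less_mono signed_exp_max)

lemma has_real_derivative_signed_exp:
  assumes "y \<noteq> 0"
  shows "(signed_exp has_real_derivative exp \<bar>y\<bar>) (at y)"
proof (cases "y > 0")
  case True
  have "((\<lambda>y. exp y - 1) has_real_derivative exp \<bar>y\<bar>) (at y)"
    using True by (auto intro!: derivative_eq_intros)
  then show ?thesis
    by (rule has_field_derivative_transform_within_open[where S="{0<..}"]) (use True in \<open>auto simp: signed_exp_def\<close>)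
next
  case False
  have "((\<lambda>y. 1 - exp (- y)) has_real_derivative exp \<bar>y\<bar>) (at y)"
    using False assms by (auto intro!: derivative_eq_intros)
  then show ?thesis
    by (rule has_field_derivative_transform_within_open[where S="{..<0}"]) (use False assms in \<open>auto simp: signed_exp_def\<close>)
qed

text \<open>The level of a slope \<open>b\<close> is the primitive of \<open>(1 + \<alpha>) / (\<bar>b\<bar> + \<bar>b\<bar> powr (- \<alpha>))\<close> that vanishes at \<open>0\<close>:
  along any \<open>C\<^sup>2\<close> function whose second derivative is at most \<open>C * (\<bar>b\<bar> + \<bar>b\<bar> powr (- \<alpha>))\<close> in absolute
  value where its slope \<open>b\<close> is not \<open>0\<close>, the level of the slope changes at speed at most
  \<open>(1 + \<alpha>) * C\<close>. Measuring slopes by their level makes the growth at infinity and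
  the degeneracy at slope \<open>0\<close> harmless at the same time. The function \<open>level_slope\<close> is the inverse.\<close>

definition level :: "real \<Rightarrow> real \<Rightarrow> real" where
  "level \<alpha> x = signed_log (signed_powr (1 + \<alpha>) x)"
definition level_slope :: "real \<Rightarrow> real \<Rightarrow> real" where
  "level_slope \<alpha> y = signed_powr (1 / (1 + \<alpha>)) (signed_exp y)"

lemma level_slope_level [simp]: "\<alpha> \<ge> 0 \<Longrightarrow> level_slope \<alpha> (level \<alpha> x) = x"
  by (simp add: level_slope_def level_def signed_powr_signed_powr)
lemma level_minus [simp]: "level \<alpha> (- x) = - level \<alpha> x" by (simp add: level_def)
lemma sgn_level_slope [simp]: "sgn (level_slope \<alpha> y) = sgn y" by (simp add: level_slope_def)

lemma strict_mono_level_slope: "\<alpha> \<ge> 0 \<Longrightarrow> strict_mono (level_slope \<alpha>)"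
  using strict_mono_signed_powr[of "1 / (1 + \<alpha>)"] strict_mono_signed_exp
  by (auto simp: level_slope_def strict_mono_def)

lemma level_le_iff [simp]: "\<alpha> \<ge> 0 \<Longrightarrow> level \<alpha> x \<le> level \<alpha> y \<longleftrightarrow> x \<le> y"
  using strict_mono_less_eq[OF strict_mono_level_slope, of \<alpha> "level \<alpha> x" "level \<alpha> y"] by simp

lemma continuous_on_level_slope: "\<alpha> \<ge> 0 \<Longrightarrow> continuous_on A (level_slope \<alpha>)"
  unfolding level_slope_def by (intro continuous_intros continuous_on_signed_exp) auto

lemma has_real_derivative_level_slope:
  assumes "\<alpha> \<ge> 0" "y \<noteq> 0"
  shows "(level_slope \<alpha> has_real_derivative
     1 / (1 + \<alpha>) * (\<bar>level_slope \<alpha> y\<bar> + \<bar>level_slope \<alpha> y\<bar> powr (- \<alpha>))) (at y)"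
proof -
  define \<beta> where "\<beta> = 1 / (1 + \<alpha>)"
  have s0: "signed_exp y \<noteq> 0" using assms by (metis sgn_signed_exp sgn_eq_0_iff)
  define X where "X = \<bar>signed_exp y\<bar>"
  have X: "X > 0" using s0 by (simp add: X_def)
  have "(level_slope \<alpha> has_real_derivative (\<beta> * \<bar>signed_exp y\<bar> powr (\<beta> - 1)) * exp \<bar>y\<bar>) (at y)"
    unfolding level_slope_def \<beta>_def[symmetric]
    by (rule DERIV_chain2[OF has_real_derivative_signed_powr[OF s0] has_real_derivative_signed_exp[OF assms(2)]])
  moreover have "exp \<bar>y\<bar> = X + 1" unfolding X_def abs_signed_exp by simp
  moreover have "X powr (\<beta> - 1) * (X + 1) = X powr \<beta> + (X powr \<beta>) powr (- \<alpha>)"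
  proof -
    have "\<beta> * (-\<alpha>) = \<beta> - 1" using assms by (simp add: \<beta>_def field_simps)
    then show ?thesis using X
      by (simp add: powr_powr distrib_left powr_diff powr_add)
  qed
  ultimately show ?thesis
    unfolding level_slope_def abs_signed_powr \<beta>_def[symmetric] X_def[symmetric] by (simp add: mult.assoc)
qed

section \<open>Subjets and secants\<close>

text \<open>The second-order subjet, with quadratic polynomials as test functions: \<open>w\<close> is touched from below
  at \<open>r\<close> by the parabola of slope \<open>b\<close> and curvature \<open>d\<close>. Touching from above is expressed by
  the subjet of \<open>- w\<close>.\<close>

definition subjet :: "(real \<Rightarrow> real) \<Rightarrow> real \<Rightarrow> real \<Rightarrow> real \<Rightarrow> bool" where
  "subjet w r b d \<longleftrightarrow> (\<forall>\<^sub>F s in nhds r. w r + b * (s - r) + d / 2 * (s - r)\<^sup>2 \<le> w s)"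

lemma second_derivative_test:
  fixes h h' :: "real \<Rightarrow> real"
  assumes h: "\<forall>\<^sub>F s in nhds r. (h has_real_derivative h' s) (at s)"
    and h': "(h' has_real_derivative d) (at r)" "h' r = 0" "d > 0"
  shows "\<forall>\<^sub>F s in nhds r. h r \<le> h s"
proof -
  obtain e1 where e1: "e1 > 0" "\<And>s. dist s r < e1 \<Longrightarrow> (h has_real_derivative h' s) (at s)"
    using h unfolding eventually_nhds_metric by blast
  obtain e2 where e2: "e2 > 0" "\<And>k. 0 < k \<Longrightarrow> k < e2 \<Longrightarrow> h' r < h' (r + k)"
    using DERIV_pos_inc_right[OF h'(1,3)] by blast
  obtain e3 where e3: "e3 > 0" "\<And>k. 0 < k \<Longrightarrow> k < e3 \<Longrightarrow> h' (r - k) < h' r"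
    using DERIV_pos_inc_left[OF h'(1,3)] by blast
  define e where "e = min e1 (min e2 e3)"
  have "h r \<le> h s" if s: "dist s r < e" for s
  proof (cases s r rule: linorder_cases)
    case less
    obtain z where z: "s < z" "z < r" "h r - h s = (r - s) * h' z"
      by (rule MVT2[OF less, of h h', THEN exE]) (use e1(2) s less in \<open>auto simp: e_def dist_real_def\<close>)
    have "h' z < 0" using e3(2)[of "r - z"] z s h'(2) by (auto simp: e_def dist_real_def)
    then show ?thesis using z less by (smt (verit) mult_nonneg_nonpos)
  next
    case greater
    obtain z where z: "r < z" "z < s" "h s - h r = (s - r) * h' z"
      by (rule MVT2[OF greater, of h h', THEN exE]) (use e1(2) s greater in \<open>auto simp: e_def dist_real_def\<close>)
    have "h' z > 0" using e2(2)[of "z - r"] z s h'(2) by (auto simp: e_def dist_real_def)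
    then show ?thesis using z greater by (smt (verit) mult_nonneg_nonneg)
  qed auto
  moreover have "e > 0" using e1 e2 e3 by (simp add: e_def)
  ultimately show ?thesis unfolding eventually_nhds_metric by blast
qed

text \<open>A touching \<open>C\<^sup>2\<close> function gives subjets for all smaller curvatures; the strict gap absorbs the
  error term of the Taylor expansion.\<close>

lemma subjet_of_touching:
  fixes \<phi> \<phi>' w :: "real \<Rightarrow> real"
  assumes \<phi>: "\<forall>\<^sub>F s in nhds r. (\<phi> has_real_derivative \<phi>' s) (at s)"
    and \<phi>': "(\<phi>' has_real_derivative d) (at r)"
    and touch: "\<forall>\<^sub>F s in nhds r. w r - \<phi> r \<le> w s - \<phi> s"
    and "d' < d"
  shows "subjet w r (\<phi>' r) d'"
proof -
  define h where "h = (\<lambda>s. \<phi> s - (\<phi>' r * (s - r) + d' / 2 * (s - r)\<^sup>2))"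
  have "\<forall>\<^sub>F s in nhds r. h r \<le> h s"
  proof (rule second_derivative_test[where h' = "\<lambda>s. \<phi>' s - (\<phi>' r + d' * (s - r))" and d = "d - d'"])
    show "\<forall>\<^sub>F s in nhds r. (h has_real_derivative \<phi>' s - (\<phi>' r + d' * (s - r))) (at s)"
      using \<phi> by eventually_elim (auto simp: h_def intro!: derivative_eq_intros)
    show "((\<lambda>s. \<phi>' s - (\<phi>' r + d' * (s - r))) has_real_derivative d - d') (at r)"
      by (auto intro!: derivative_eq_intros \<phi>')
  qed (use assms(4) in auto)
  with touch show ?thesis
    unfolding subjet_def by eventually_elim (simp add: h_def)
qed

text \<open>The viscosity inequality only speaks about touching points, whereas the regularity to be proved
  is about difference quotients. Barriers with prescribed slopes translate one into the other.\<close>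

definition secant :: "(real \<Rightarrow> real) \<Rightarrow> real \<Rightarrow> real \<Rightarrow> real" where
  "secant w x y = (w y - w x) / (y - x)"

lemma secant_commute: "secant w x y = secant w y x"
  unfolding secant_def by (metis minus_diff_eq minus_divide_divide)

lemma secant_minus: "secant (\<lambda>x. - w x) x y = - secant w x y"
  by (simp add: secant_def diff_divide_distrib)

text \<open>A convex kink is incompatible with an upper bound on the curvature of subjets: if \<open>\<phi>\<close> is a barrier
  with larger curvature whose slopes lie strictly between the two secant slopes, then \<open>w - \<phi>\<close>
  is smaller at \<open>m\<close> than at both ends, hence has an interior minimum, and there \<open>\<phi>\<close> touches \<open>w\<close> from below.
  The slopes of the barrier must avoid \<open>0\<close>, because nothing is known about test functions
  with vanishing slope.\<close>

lemma subjet_barrier: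
  fixes w \<phi>' :: "real \<Rightarrow> real"
  assumes pq: "p < m" "m < q"
    and w: "continuous_on {p..q} w"
    and bound: "\<And>r b d. p < r \<Longrightarrow> r < q \<Longrightarrow> b \<noteq> 0 \<Longrightarrow> subjet w r b d \<Longrightarrow> d \<le> B b"
    and \<phi>': "\<And>r. p \<le> r \<Longrightarrow> r \<le> q \<Longrightarrow> (\<phi>' has_real_derivative \<phi>'' r) (at r)"
      "\<And>r. p \<le> r \<Longrightarrow> r \<le> q \<Longrightarrow> \<phi>' r \<noteq> 0"
      "\<And>r. p \<le> r \<Longrightarrow> r \<le> q \<Longrightarrow> B (\<phi>' r) < \<phi>'' r"
    and left: "\<And>r. p \<le> r \<Longrightarrow> r \<le> m \<Longrightarrow> secant w p m < \<phi>' r"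
    and right: "\<And>r. m \<le> r \<Longrightarrow> r \<le> q \<Longrightarrow> \<phi>' r < secant w m q"
  shows False
proof -
  have "continuous_on {p..q} \<phi>'"
    using \<phi>'(1) by (intro DERIV_continuous_on) (auto intro: has_field_derivative_at_within)
  then obtain \<phi> where \<phi>0: "\<And>r. r \<in> {p..q} \<Longrightarrow> (\<phi> has_vector_derivative \<phi>' r) (at r within {p..q})"
    using antiderivative_continuous[of p q \<phi>'] by metis
  have \<phi>: "(\<phi> has_real_derivative \<phi>' r) (at r)" if "p < r" "r < q" for r
    using \<phi>0[of r] that at_within_interior[of r "{p..q}"]
    by (simp add: has_real_derivative_iff_has_vector_derivative)
  have c\<phi>: "continuous_on {p..q} \<phi>"
    using \<phi>0 has_vector_derivative_continuous continuous_on_eq_continuous_within by blast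
  have mvt: "\<exists>z>x. z < y \<and> \<phi> y - \<phi> x = (y - x) * \<phi>' z" if "p \<le> x" "x < y" "y \<le> q" for x y
  proof -
    have c: "continuous_on {x..y} \<phi>" using c\<phi> that by (auto elim: continuous_on_subset)
    have d: "\<phi> differentiable (at r)" if "x < r" "r < y" for r
      using \<phi>[of r] that \<open>p \<le> x\<close> \<open>y \<le> q\<close> by (auto simp: real_differentiable_def)
    obtain l z where z: "x < z" "z < y" "DERIV \<phi> z :> l" "\<phi> y - \<phi> x = (y - x) * l"
      using MVT[OF \<open>x < y\<close> c] d by blast
    have "DERIV \<phi> z :> \<phi>' z" using z that by (intro \<phi>) auto
    with z(3) have "l = \<phi>' z" by (rule DERIV_unique)
    with z show ?thesis by blast
  qed
  have L: "w m - \<phi> m < w p - \<phi> p"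
  proof -
    obtain z where z: "p < z" "z < m" "\<phi> m - \<phi> p = (m - p) * \<phi>' z" using mvt[of p m] pq by auto
    have "w m - w p < (m - p) * \<phi>' z"
      using left[of z] z pq by (simp add: secant_def field_simps)
    then show ?thesis using z by simp
  qed
  have R: "w m - \<phi> m < w q - \<phi> q"
  proof -
    obtain z where z: "m < z" "z < q" "\<phi> q - \<phi> m = (q - m) * \<phi>' z" using mvt[of m q] pq by auto
    have "(q - m) * \<phi>' z < w q - w m"
      using right[of z] z pq by (simp add: secant_def field_simps)
    then show ?thesis using z by simp
  qed
  have "continuous_on {p..q} (\<lambda>s. w s - \<phi> s)" by (intro continuous_intros w c\<phi>)
  then obtain t where t: "t \<in> {p..q}" "\<And>s. s \<in> {p..q} \<Longrightarrow> w t - \<phi> t \<le> w s - \<phi> s"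
    using continuous_attains_inf[of "{p..q}" "\<lambda>s. w s - \<phi> s"] pq by fastforce
  have "t \<noteq> p" "t \<noteq> q" using t(2)[of m] L R pq by auto
  then have tt: "p < t" "t < q" using t(1) by auto
  have nh: "\<forall>\<^sub>F s in nhds t. s \<in> {p<..<q}" using tt by (intro eventually_nhds_in_open) auto
  have "subjet w t (\<phi>' t) d'" if "d' < \<phi>'' t" for d'
  proof (rule subjet_of_touching[OF _ _ _ that])
    show "\<forall>\<^sub>F s in nhds t. (\<phi> has_real_derivative \<phi>' s) (at s)"
      using nh by eventually_elim (use \<phi> in auto)
    show "(\<phi>' has_real_derivative \<phi>'' t) (at t)" using \<phi>'(1) tt by simp
    show "\<forall>\<^sub>F s in nhds t. w t - \<phi> t \<le> w s - \<phi> s"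
      using nh by eventually_elim (use t(2) in auto)
  qed
  then have "\<And>d'. d' < \<phi>'' t \<Longrightarrow> d' \<le> B (\<phi>' t)" using bound[of t "\<phi>' t"] tt \<phi>'(2)[of t] by auto
  then have "\<phi>'' t \<le> B (\<phi>' t)" by (rule dense_le)
  with \<phi>'(3)[of t] tt show False by simp
qed

text \<open>The barriers are the functions whose slope has the affine level \<open>c + L * (s - p)\<close>. A jump of the
  secant level by more than \<open>3 * L * (q - p)\<close> leaves room for a window of length \<open>L * (q - p)\<close> strictly
  inside the jump and avoiding level \<open>0\<close>, so that the barrier has no critical point.\<close>

lemma secant_level_bound:
  fixes w :: "real \<Rightarrow> real"
  assumes \<alpha>: "\<alpha> \<ge> 0" and L: "L > 0" "(1 + \<alpha>) * C < L"
    and pq: "p < m" "m < q"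
    and w: "continuous_on {p..q} w"
    and bound: "\<And>r b d. p < r \<Longrightarrow> r < q \<Longrightarrow> b \<noteq> 0 \<Longrightarrow> subjet w r b d \<Longrightarrow> d \<le> C * (\<bar>b\<bar> + \<bar>b\<bar> powr (- \<alpha>))"
  shows "level \<alpha> (secant w m q) \<le> level \<alpha> (secant w p m) + 3 * L * (q - p)"
proof (rule ccontr)
  define l where "l = L * (q - p)"
  define X where "X = level \<alpha> (secant w p m)"
  define Z where "Z = level \<alpha> (secant w m q)"
  assume "\<not> ?thesis"
  then have XZ: "X + 3 * l < Z" by (simp add: X_def Z_def l_def)
  have l: "l > 0" using L pq by (simp add: l_def)
  \<comment> \<open>the interval from \<open>X\<close> to \<open>X + 3 * l\<close> has a half that avoids \<open>0\<close>, and \<open>3/2 * l\<close> exceeds the length of the window\<close>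
  obtain c where c: "X < c" "c + l < Z" "c + l < 0 \<or> c > 0"
  proof (cases "X + 3/2 * l > 0")
    case True
    then show ?thesis using XZ l by (intro that[of "X + 7/4 * l"]) auto
  next
    case False
    then show ?thesis using XZ l by (intro that[of "X + 1/4 * l"]) auto
  qed
  define y where "y = (\<lambda>s. c + L * (s - p))"
  have y: "c \<le> y s \<and> y s \<le> c + l \<and> y s \<noteq> 0" if "p \<le> s" "s \<le> q" for s
  proof -
    have "0 \<le> L * (s - p)" "L * (s - p) \<le> l" using L that by (auto simp: l_def)
    then show ?thesis using c by (auto simp: y_def)
  qed
  have nz: "level_slope \<alpha> x \<noteq> 0" if "x \<noteq> 0" for x
    using that by (metis sgn_level_slope sgn_eq_0_iff)
  note mono = strict_mono_less[OF strict_mono_level_slope[OF \<alpha>]]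
  show False
  proof (rule subjet_barrier[OF pq w bound, where \<phi>' = "\<lambda>s. level_slope \<alpha> (y s)" and
      \<phi>'' = "\<lambda>s. 1 / (1 + \<alpha>) * (\<bar>level_slope \<alpha> (y s)\<bar> + \<bar>level_slope \<alpha> (y s)\<bar> powr (- \<alpha>)) * L"])
    fix r assume r: "p \<le> r" "r \<le> q"
    show "((\<lambda>s. level_slope \<alpha> (y s)) has_real_derivative
       1 / (1 + \<alpha>) * (\<bar>level_slope \<alpha> (y r)\<bar> + \<bar>level_slope \<alpha> (y r)\<bar> powr (- \<alpha>)) * L) (at r)"
      by (rule DERIV_chain2[OF has_real_derivative_level_slope[OF \<alpha>]])
         (use y[OF r] in \<open>auto simp: y_def intro!: derivative_eq_intros\<close>)
    show n: "level_slope \<alpha> (y r) \<noteq> 0" using y[OF r] nz by simp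
    have "C < L / (1 + \<alpha>)" using L \<alpha> by (simp add: field_simps)
    then have "C * (\<bar>level_slope \<alpha> (y r)\<bar> + \<bar>level_slope \<alpha> (y r)\<bar> powr - \<alpha>) <
       L / (1 + \<alpha>) * (\<bar>level_slope \<alpha> (y r)\<bar> + \<bar>level_slope \<alpha> (y r)\<bar> powr - \<alpha>)"
      using n by (intro mult_strict_right_mono) (auto intro: add_pos_nonneg)
    then show "C * (\<bar>level_slope \<alpha> (y r)\<bar> + \<bar>level_slope \<alpha> (y r)\<bar> powr - \<alpha>)
       < 1 / (1 + \<alpha>) * (\<bar>level_slope \<alpha> (y r)\<bar> + \<bar>level_slope \<alpha> (y r)\<bar> powr - \<alpha>) * L"
      by (simp add: mult_ac)
  next
    fix r assume r: "p \<le> r" "r \<le> m"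
    then have "level_slope \<alpha> X < level_slope \<alpha> (y r)" using y[of r] pq c(1) by (simp add: mono)
    then show "secant w p m < level_slope \<alpha> (y r)" using \<alpha> by (simp add: X_def)
  next
    fix r assume r: "m \<le> r" "r \<le> q"
    then have "level_slope \<alpha> (y r) < level_slope \<alpha> Z" using y[of r] pq c(2) by (simp add: mono)
    then show "level_slope \<alpha> (y r) < secant w m q" using \<alpha> by (simp add: Z_def)
  qed
qed

section \<open>From secant bounds and subjets to derivatives\<close>

lemma secant_between:
  assumes "p < m" "m < q"
  shows "min (secant w p m) (secant w m q) \<le> secant w p q" "secant w p q \<le> max (secant w p m) (secant w m q)"
proof -
  have e: "(q - p) * secant w p q = (m - p) * secant w p m + (q - m) * secant w m q"
    using assms by (simp add: secant_def)
  define lo where "lo = min (secant w p m) (secant w m q)"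
  define hi where "hi = max (secant w p m) (secant w m q)"
  have "(m - p) * lo + (q - m) * lo \<le> (m - p) * secant w p m + (q - m) * secant w m q"
    "(m - p) * secant w p m + (q - m) * secant w m q \<le> (m - p) * hi + (q - m) * hi"
    using assms by (intro add_mono mult_left_mono; simp add: lo_def hi_def)+
  then have "(q - p) * lo \<le> (q - p) * secant w p q" "(q - p) * secant w p q \<le> (q - p) * hi"
    unfolding e by (simp_all add: algebra_simps)
  then show "lo \<le> secant w p q" "secant w p q \<le> hi" using assms by simp_all
qed

text \<open>If the levels of adjacent secants differ by at most a multiple of their total length, then all
  short secants that end at \<open>m\<close> have nearly the same level. So the difference
  quotients at \<open>m\<close> converge, from both sides to the same limit, and this limit has a level that
  is Lipschitz in \<open>m\<close>.\<close>

lemma C1_of_secant_levels: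
  fixes w :: "real \<Rightarrow> real"
  assumes \<alpha>: "\<alpha> \<ge> 0" and "M \<ge> 0"
    and slopes: "\<And>p m q. lo < p \<Longrightarrow> p < m \<Longrightarrow> m < q \<Longrightarrow> q < hi \<Longrightarrow>
      \<bar>level \<alpha> (secant w m q) - level \<alpha> (secant w p m)\<bar> \<le> M * (q - p)"
  obtains w' where "\<And>r. r \<in> {lo<..<hi} \<Longrightarrow> (w has_real_derivative w' r) (at r)"
    "continuous_on {lo<..<hi} w'"
proof -
  define J where "J = {lo<..<hi}"
  define T where "T = (\<lambda>x y. level \<alpha> (secant w x y))"
  have T_comm: "T x y = T y x" for x y by (simp add: T_def secant_commute)
  have sub: "\<bar>T p q - T p m\<bar> \<le> M * (q - p) \<and> \<bar>T p q - T m q\<bar> \<le> M * (q - p)"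
    if "lo < p" "p < m" "m < q" "q < hi" for p m q
  proof -
    have "T p m \<le> T p q \<or> T m q \<le> T p q" "T p q \<le> T p m \<or> T p q \<le> T m q"
      using secant_between[OF that(2,3), of w] \<alpha> by (auto simp: T_def min_def max_def split: if_splits)
    then show ?thesis using slopes[OF that] unfolding T_def by linarith
  qed
  have near0: "\<bar>T m x - T m y\<bar> \<le> 2 * M * \<delta>"
    if J: "m \<in> J" "x \<in> J" "y \<in> J" and ne: "x \<noteq> m" "y \<noteq> m" and "x < y"
      and \<delta>: "\<bar>x - m\<bar> \<le> \<delta>" "\<bar>y - m\<bar> \<le> \<delta>" for m x y \<delta>
  proof -
    have le: "M * t \<le> 2 * M * \<delta>" if "t \<le> 2 * \<delta>" for t
      using mult_left_mono[OF that \<open>M \<ge> 0\<close>] by simp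
    consider "m < x" | "x < m" "m < y" | "y < m" using ne by linarith
    then show ?thesis
    proof cases
      case 1
      then show ?thesis using sub[of m x y] J \<open>x < y\<close> \<delta> le[of "y - m"] by (auto simp: J_def)
    next
      case 2
      then show ?thesis
        using slopes[of x m y] J \<delta> le[of "y - x"] T_comm[of m x] by (auto simp: J_def T_def)
    next
      case 3
      then show ?thesis
        using sub[of x y m] J \<open>x < y\<close> \<delta> le[of "m - x"] T_comm[of m x] T_comm[of m y]
        by (auto simp: J_def)
    qed
  qed
  have near: "\<bar>T m x - T m y\<bar> \<le> 2 * M * \<delta>"
    if J: "m \<in> J" "x \<in> J" "y \<in> J" and ne: "x \<noteq> m" "y \<noteq> m"
      and \<delta>: "\<bar>x - m\<bar> \<le> \<delta>" "\<bar>y - m\<bar> \<le> \<delta>" for m x y \<delta>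
  proof (cases x y rule: linorder_cases)
    case less
    show ?thesis by (rule near0[OF J ne less \<delta>])
  next
    case equal
    then show ?thesis using \<delta>(1) \<open>M \<ge> 0\<close> by simp
  next
    case greater
    show ?thesis using near0[OF J(1,3,2) ne(2,1) greater \<delta>(2,1)] by (simp add: abs_minus_commute)
  qed
  have "\<exists>l. \<forall>x\<in>J. x \<noteq> m \<longrightarrow> \<bar>T m x - l\<bar> \<le> 2 * M * \<bar>x - m\<bar>" if m: "m \<in> J" for m
  proof -
    \<comment> \<open>any sequence of points of \<open>J\<close> other than \<open>m\<close> that tends to \<open>m\<close> would serve\<close>
    define x where "x = (\<lambda>n::nat. m + (hi - m) / real (n + 2))"
    have x_lim: "x \<longlonglongrightarrow> m"
    proof -
      have "(\<lambda>n. m + (hi - m) / real (n + 2)) \<longlonglongrightarrow> m + 0"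
        by (intro tendsto_intros LIMSEQ_ignore_initial_segment[OF lim_const_over_n])
      then show ?thesis by (simp add: x_def)
    qed
    have x: "x n \<in> J" "x n \<noteq> m" for n
    proof -
      have "hi - m > 0" using m by (simp add: J_def)
      moreover have "(hi - m) / real (n + 2) < hi - m"
        using mult_strict_left_mono[OF _ \<open>hi - m > 0\<close>, of 1 "real (n + 2)"]
        by (simp add: divide_less_eq)
      moreover have "(hi - m) / real (n + 2) > 0"
        using \<open>hi - m > 0\<close> by (intro divide_pos_pos) auto
      ultimately show "x n \<in> J" "x n \<noteq> m" using m unfolding x_def J_def by auto
    qed
    have small: "\<forall>\<^sub>F n in sequentially. \<bar>x n - m\<bar> \<le> \<delta>" if "\<delta> > 0" for \<delta>
      using tendstoD[OF x_lim that] by eventually_elim (simp add: dist_real_def)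
    have "Cauchy (\<lambda>n. T m (x n))"
    proof (rule metric_CauchyI)
      fix e :: real assume "e > 0"
      define \<delta> where "\<delta> = e / (2 * M + 1)"
      have \<delta>: "\<delta> > 0" "2 * M * \<delta> < e"
        using \<open>e > 0\<close> \<open>M \<ge> 0\<close> by (auto simp: \<delta>_def field_simps)
      obtain N where N: "\<And>n. n \<ge> N \<Longrightarrow> \<bar>x n - m\<bar> \<le> \<delta>"
        using small[OF \<delta>(1)] unfolding eventually_sequentially by blast
      have "dist (T m (x n)) (T m (x k)) < e" if "n \<ge> N" "k \<ge> N" for n k
        using near[OF m x(1) x(1) x(2) x(2) N[OF that(1)] N[OF that(2)]] \<delta>(2)
        by (simp add: dist_real_def)
      then show "\<exists>N. \<forall>n\<ge>N. \<forall>k\<ge>N. dist (T m (x n)) (T m (x k)) < e" by blast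
    qed
    then obtain l where l: "(\<lambda>n. T m (x n)) \<longlonglongrightarrow> l"
      using Cauchy_convergent_iff convergent_def by blast
    have "\<bar>T m z - l\<bar> \<le> 2 * M * \<bar>z - m\<bar>" if z: "z \<in> J" "z \<noteq> m" for z
    proof (rule tendsto_upperbound)
      show "(\<lambda>n. \<bar>T m z - T m (x n)\<bar>) \<longlonglongrightarrow> \<bar>T m z - l\<bar>" by (intro tendsto_intros l)
      have "\<forall>\<^sub>F n in sequentially. \<bar>x n - m\<bar> \<le> \<bar>z - m\<bar>" using z by (intro small) auto
      then show "\<forall>\<^sub>F n in sequentially. \<bar>T m z - T m (x n)\<bar> \<le> 2 * M * \<bar>z - m\<bar>"
        by eventually_elim (use near[OF m z(1) x(1) z(2) x(2)] in auto)
    qed auto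
    then show ?thesis by blast
  qed
  then obtain l where l: "\<And>m x. m \<in> J \<Longrightarrow> x \<in> J \<Longrightarrow> x \<noteq> m \<Longrightarrow> \<bar>T m x - l m\<bar> \<le> 2 * M * \<bar>x - m\<bar>"
    by metis
  show thesis
  proof
    fix m assume "m \<in> {lo<..<hi}"
    then have m: "m \<in> J" by (simp add: J_def)
    have "((\<lambda>x. 2 * M * \<bar>x - m\<bar>) \<longlongrightarrow> 2 * M * \<bar>m - m\<bar>) (at m)" by (intro tendsto_intros)
    then have 0: "((\<lambda>x. 2 * M * \<bar>x - m\<bar>) \<longlongrightarrow> 0) (at m)" by simp
    have ev: "\<forall>\<^sub>F x in at m. x \<in> J \<and> x \<noteq> m"
      using m by (intro eventually_conj eventually_at_in_open') (auto simp: J_def eventually_at_filter)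
    have "((\<lambda>x. T m x - l m) \<longlongrightarrow> 0) (at m)"
      by (rule Lim_null_comparison[OF _ 0]) (use ev in eventually_elim, use l[OF m] in auto)
    then have "(T m \<longlongrightarrow> l m) (at m)" by (simp add: LIM_zero_iff)
    then have "((\<lambda>x. level_slope \<alpha> (T m x)) \<longlongrightarrow> level_slope \<alpha> (l m)) (at m)"
      by (intro continuous_on_tendsto_compose[OF continuous_on_level_slope[OF \<alpha>, of UNIV]]) auto
    then show "(w has_real_derivative level_slope \<alpha> (l m)) (at m)"
      unfolding has_field_derivative_iff by (simp add: T_def secant_def \<alpha>)
  next
    have "\<bar>l x - l m\<bar> \<le> 4 * M * \<bar>x - m\<bar>" if "m \<in> J" "x \<in> J" for x m
      using l[OF that] l[OF that(2,1)] T_comm[of m x] by (cases "x = m") (auto simp: abs_minus_commute)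
    then have "(4 * M)-lipschitz_on J l"
      using \<open>M \<ge> 0\<close> by (auto simp: lipschitz_on_def dist_real_def)
    then have "continuous_on J l" by (rule lipschitz_on_continuous_on)
    then show "continuous_on {lo<..<hi} (\<lambda>m. level_slope \<alpha> (l m))"
      unfolding J_def[symmetric]
      by (rule continuous_on_compose2[OF continuous_on_level_slope[OF \<alpha>]]) auto
  qed
qed

text \<open>If \<open>w' - c * s\<close> took a larger value at \<open>y\<close> than at \<open>x\<close>, then subtracting a linear function of intermediate
  slope \<open>k\<close> from \<open>w - c / 2 * s\<^sup>2\<close> would give a function decreasing at \<open>x\<close> and increasing at \<open>y\<close>; at its
  interior minimum a parabola of curvature \<open>c\<close> touches \<open>w\<close> from below.\<close>

lemma deriv_growth_of_subjet:
  fixes w w' :: "real \<Rightarrow> real"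
  assumes "x \<le> y"
    and w': "\<And>s. s \<in> {x..y} \<Longrightarrow> (w has_real_derivative w' s) (at s)"
    and jets: "\<And>s d. s \<in> {x..y} \<Longrightarrow> subjet w s (w' s) d \<Longrightarrow> d < c"
  shows "w' y - w' x \<le> c * (y - x)"
proof (rule ccontr)
  assume "\<not> ?thesis"
  then have "w' x - c * x < w' y - c * y" by (simp add: algebra_simps)
  then obtain k where k: "w' x - c * x < k" "k < w' y - c * y" using dense by blast
  have "x < y" using k \<open>x \<le> y\<close> by (cases "x = y") auto
  define h where "h = (\<lambda>s. w s - c / 2 * s\<^sup>2 - k * s)"
  have h': "(h has_real_derivative w' s - c * s - k) (at s)" if "s \<in> {x..y}" for s
    unfolding h_def by (auto intro!: derivative_eq_intros w'[OF that])
  have "continuous_on {x..y} h"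
    by (rule DERIV_continuous_on[OF has_field_derivative_at_within[OF h']])
  then obtain t where t: "t \<in> {x..y}" "\<And>s. s \<in> {x..y} \<Longrightarrow> h t \<le> h s"
    using continuous_attains_inf[of "{x..y}" h] \<open>x < y\<close> by fastforce
  have "t \<noteq> x"
  proof
    assume "t = x"
    obtain e where "e > 0" and e: "\<And>k. 0 < k \<Longrightarrow> k < e \<Longrightarrow> h (x + k) < h x"
      using DERIV_neg_dec_right[OF h'[of x]] k \<open>x < y\<close> by auto
    have "h (x + min (e / 2) (y - x)) < h x" using \<open>e > 0\<close> \<open>x < y\<close> by (intro e) auto
    moreover have "h x \<le> h (x + min (e / 2) (y - x))"
      using t(2) \<open>t = x\<close> \<open>e > 0\<close> \<open>x < y\<close> by auto
    ultimately show False by simp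
  qed
  moreover have "t \<noteq> y"
  proof
    assume "t = y"
    obtain e where "e > 0" and e: "\<And>k. 0 < k \<Longrightarrow> k < e \<Longrightarrow> h (y - k) < h y"
      using DERIV_pos_inc_left[OF h'[of y]] k \<open>x < y\<close> by auto
    have "h (y - min (e / 2) (y - x)) < h y" using \<open>e > 0\<close> \<open>x < y\<close> by (intro e) auto
    moreover have "h y \<le> h (y - min (e / 2) (y - x))"
      using t(2) \<open>t = y\<close> \<open>e > 0\<close> \<open>x < y\<close> by auto
    ultimately show False by simp
  qed
  ultimately have tt: "t \<in> {x<..<y}" using t(1) by auto
  then have nh: "\<forall>\<^sub>F s in nhds t. s \<in> {x<..<y}" by (intro eventually_nhds_in_open) auto
  then obtain e where e: "e > 0" "\<And>s. dist s t < e \<Longrightarrow> s \<in> {x<..<y}"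
    unfolding eventually_nhds_metric by blast
  have "w' t - c * t - k = 0"
    by (rule DERIV_local_min[OF h'[OF t(1)] e(1)])
       (use e(2) t(2) in \<open>force simp: dist_real_def abs_minus_commute\<close>)
  then have k_eq: "k = w' t - c * t" by simp
  have "subjet w t (w' t) c"
    unfolding subjet_def using nh
  proof eventually_elim
    case (elim s)
    then have "h t \<le> h s" using t(2) by auto
    then show ?case by (simp add: h_def k_eq power2_eq_square algebra_simps add_divide_distrib diff_divide_distrib)
  qed
  then show False using jets[OF t(1)] by blast
qed

text \<open>For a \<open>C\<^sup>1\<close> function that satisfies \<open>w'' = \<gamma>\<close> in the viscosity sense with a continuous \<open>\<gamma>\<close>, the equation
  holds classically: near \<open>r\<close> the difference quotients of \<open>w'\<close> are trapped between \<open>\<gamma> r - e / 2\<close>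
  and \<open>\<gamma> r + e / 2\<close>.\<close>

lemma has_derivative_of_subjets:
  fixes w w' \<gamma> :: "real \<Rightarrow> real"
  assumes J: "open J" "r \<in> J"
    and w': "\<And>s. s \<in> J \<Longrightarrow> (w has_real_derivative w' s) (at s)"
    and sub: "\<And>s d. s \<in> J \<Longrightarrow> subjet w s (w' s) d \<Longrightarrow> d \<le> \<gamma> s"
    and super: "\<And>s d. s \<in> J \<Longrightarrow> subjet (\<lambda>s. - w s) s (- w' s) d \<Longrightarrow> d \<le> - \<gamma> s"
    and \<gamma>: "isCont \<gamma> r"
  shows "(w' has_real_derivative \<gamma> r) (at r)"
  unfolding has_field_derivative_iff LIM_def
proof (intro allI impI)
  fix e :: real assume "e > 0"
  have "(\<gamma> \<longlongrightarrow> \<gamma> r) (nhds r)" using \<gamma> by (simp add: isCont_def tendsto_at_iff_tendsto_nhds)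
  from tendstoD[OF this, of "e / 2"] have "\<forall>\<^sub>F s in nhds r. dist (\<gamma> s) (\<gamma> r) < e / 2 \<and> s \<in> J"
    using J \<open>e > 0\<close> by (intro eventually_conj eventually_nhds_in_open) auto
  then obtain \<delta> where \<delta>: "\<delta> > 0" "\<And>s. dist s r < \<delta> \<Longrightarrow> \<bar>\<gamma> s - \<gamma> r\<bar> < e / 2 \<and> s \<in> J"
    unfolding eventually_nhds_metric dist_real_def by blast
  have bd: "\<bar>(w' y - w' x) - \<gamma> r * (y - x)\<bar> \<le> e / 2 * (y - x)"
    if "x \<le> y" "dist x r < \<delta>" "dist y r < \<delta>" for x y
  proof -
    have s: "\<bar>\<gamma> s - \<gamma> r\<bar> < e / 2" "s \<in> J" if "s \<in> {x..y}" for s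
      using \<delta>(2)[of s] that \<open>dist x r < \<delta>\<close> \<open>dist y r < \<delta>\<close> by (auto simp: dist_real_def)
    have "w' y - w' x \<le> (\<gamma> r + e / 2) * (y - x)"
    proof (rule deriv_growth_of_subjet[OF that(1)])
      show "(w has_real_derivative w' s) (at s)" if "s \<in> {x..y}" for s
        using w'[OF s(2)[OF that]] .
      show "d < \<gamma> r + e / 2" if "s \<in> {x..y}" "subjet w s (w' s) d" for s d
        using sub[OF s(2) that(2)] s(1)[of s] that(1) by linarith
    qed
    moreover have "(- w' y) - (- w' x) \<le> (- \<gamma> r + e / 2) * (y - x)"
    proof (rule deriv_growth_of_subjet[OF that(1)])
      show "((\<lambda>s. - w s) has_real_derivative - w' s) (at s)" if "s \<in> {x..y}" for s
        using w'[OF s(2)[OF that]] by (rule DERIV_minus)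
      show "d < - \<gamma> r + e / 2" if "s \<in> {x..y}" "subjet (\<lambda>s. - w s) s (- w' s) d" for s d
        using super[OF s(2) that(2)] s(1)[of s] that(1) by linarith
    qed
    ultimately show ?thesis unfolding distrib_right minus_mult_left[symmetric] by linarith
  qed
  have "norm ((w' x - w' r) / (x - r) - \<gamma> r) < e" if "x \<noteq> r" "norm (x - r) < \<delta>" for x
  proof -
    have "\<bar>(w' x - w' r) - \<gamma> r * (x - r)\<bar> \<le> e / 2 * \<bar>x - r\<bar>"
    proof (cases "x < r")
      case True
      have "(w' x - w' r) - \<gamma> r * (x - r) = - ((w' r - w' x) - \<gamma> r * (r - x))"
        by (simp add: algebra_simps)
      then have eq: "\<bar>(w' x - w' r) - \<gamma> r * (x - r)\<bar> = \<bar>(w' r - w' x) - \<gamma> r * (r - x)\<bar>"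
        by (simp only: abs_minus_cancel)
      show ?thesis unfolding eq using bd[of x r] that \<delta>(1) True by (simp add: dist_real_def)
    next
      case False
      then show ?thesis using bd[of r x] that \<delta>(1) by (simp add: dist_real_def)
    qed
    also have "\<dots> < e * \<bar>x - r\<bar>" using that \<open>e > 0\<close> by simp
    also have "(w' x - w' r) - \<gamma> r * (x - r) = ((w' x - w' r) / (x - r) - \<gamma> r) * (x - r)"
      using that by (simp add: field_simps)
    finally show ?thesis using that by (simp add: abs_mult)
  qed
  with \<delta>(1) show "\<exists>\<delta>>0. \<forall>x. x \<noteq> r \<and> dist x r < \<delta> \<longrightarrow> dist ((w' x - w' r) / (x - r)) (\<gamma> r) < e"
    unfolding dist_norm by blast
qed

text \<open>Only the last zero before \<open>r\<close> matters: after it \<open>y\<close> has a constant sign, and the mean value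
  theorem applies to \<open>\<bar>y\<bar>\<close>.\<close>

lemma abs_growth:
  fixes y y' :: "real \<Rightarrow> real"
  assumes "s \<le> r" "L \<ge> 0" and y: "continuous_on {s..r} y"
    and y': "\<And>t. s < t \<Longrightarrow> t < r \<Longrightarrow> y t \<noteq> 0 \<Longrightarrow> (y has_real_derivative y' t) (at t) \<and> sgn (y t) * y' t \<le> L"
  shows "\<bar>y r\<bar> \<le> \<bar>y s\<bar> + L * (r - s)"
proof (cases "y r = 0 \<or> r = s")
  case True
  then show ?thesis using assms by auto
next
  case False
  then have "s < r" "y r \<noteq> 0" using \<open>s \<le> r\<close> by auto
  obtain z where z: "s \<le> z" "z < r" "z = s \<or> y z = 0" "\<And>t. z < t \<Longrightarrow> t \<le> r \<Longrightarrow> y t \<noteq> 0"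
  proof (cases "\<exists>t\<in>{s..r}. y t = 0")
    case True
    define Z where "Z = {t \<in> {s..r}. y t = 0}"
    have "closed Z" unfolding Z_def by (intro continuous_closed_preimage_constant y) auto
    moreover have "bounded Z" by (rule bounded_subset[of "{s..r}"]) (auto simp: Z_def)
    ultimately have "compact Z" by (simp add: compact_eq_bounded_closed)
    moreover have "Z \<noteq> {}" using True by (auto simp: Z_def)
    ultimately obtain z where z: "z \<in> Z" "\<And>t. t \<in> Z \<Longrightarrow> t \<le> z"
      using compact_attains_sup[of Z] by blast
    have "z \<noteq> r" using z(1) \<open>y r \<noteq> 0\<close> by (auto simp: Z_def)
    moreover have "y t \<noteq> 0" if "z < t" "t \<le> r" for t
      using z(2)[of t] z(1) that by (auto simp: Z_def)
    ultimately show ?thesis using z(1) by (intro that[of z]) (auto simp: Z_def)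
  next
    case False
    then show ?thesis using \<open>s < r\<close> by (intro that[of s]) auto
  qed
  have cz: "continuous_on {x..r} y" if "z \<le> x" for x
    using y z(1) that by (auto elim: continuous_on_subset)
  have sgn: "sgn (y t) = sgn (y r)" if t: "z < t" "t < r" for t
  proof (rule ccontr)
    assume "sgn (y t) \<noteq> sgn (y r)"
    then have "y t < 0 \<and> 0 < y r \<or> 0 < y t \<and> y r < 0"
      using z(4)[of t] \<open>y r \<noteq> 0\<close> t by (auto simp: sgn_if split: if_splits)
    then obtain v where "t \<le> v" "v \<le> r" "y v = 0"
      using IVT'[of y t 0 r] IVT2'[of y r 0 t] cz[of t] t by force
    then show False using z(4)[of v] t by simp
  qed
  define \<sigma> where "\<sigma> = sgn (y r)"
  have "\<exists>l x. z < x \<and> x < r \<and> ((\<lambda>t. \<sigma> * y t) has_real_derivative l) (at x) \<and>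
      \<sigma> * y r - \<sigma> * y z = (r - z) * l"
  proof (rule MVT[OF z(2)])
    show "continuous_on {z..r} (\<lambda>t. \<sigma> * y t)" by (intro continuous_intros cz) auto
    show "(\<lambda>t. \<sigma> * y t) differentiable (at x)" if "z < x" "x < r" for x
      using y'[of x] z that by (auto simp: real_differentiable_def intro!: exI DERIV_cmult)
  qed
  then obtain l x where x: "z < x" "x < r" "((\<lambda>t. \<sigma> * y t) has_real_derivative l) (at x)"
    "\<sigma> * y r - \<sigma> * y z = (r - z) * l" by blast
  have "((\<lambda>t. \<sigma> * y t) has_real_derivative \<sigma> * y' x) (at x)" "sgn (y x) * y' x \<le> L"
    using y'[of x] z x by (auto intro!: DERIV_cmult)
  then have "l \<le> L" using DERIV_unique[OF x(3)] sgn[OF x(1,2)] by (simp add: \<sigma>_def)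
  then have "(r - z) * l \<le> (r - z) * L"
    using z by (intro mult_left_mono) auto
  also have "\<dots> \<le> (r - s) * L"
    using z \<open>L \<ge> 0\<close> by (intro mult_right_mono) auto
  finally have "(r - z) * l \<le> (r - s) * L" .
  moreover have "\<sigma> * y z \<le> \<bar>y s\<bar>"
    using z(3) \<open>y r \<noteq> 0\<close> by (auto simp: \<sigma>_def sgn_if)
  moreover have "\<sigma> * y r = \<bar>y r\<bar>" by (simp add: \<sigma>_def abs_sgn)
  ultimately show ?thesis using x(4) by (simp add: mult.commute)
qed

text \<open>Across a zero, the bound is the sum of the bounds for \<open>\<bar>y\<bar>\<close> on both sides of it.\<close>

lemma lipschitz_off_zeros:
  fixes y y' :: "real \<Rightarrow> real"
  assumes "s \<le> r" "C \<ge> 0" and y: "continuous_on {s..r} y"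
    and y': "\<And>t. s < t \<Longrightarrow> t < r \<Longrightarrow> y t \<noteq> 0 \<Longrightarrow> (y has_real_derivative y' t) (at t) \<and> \<bar>y' t\<bar> \<le> C"
  shows "\<bar>y r - y s\<bar> \<le> C * (r - s)"
proof (cases "\<exists>z\<in>{s..r}. y z = 0")
  case True
  then obtain z where z: "s \<le> z" "z \<le> r" "y z = 0" by auto
  have sg: "sgn v * k \<le> C" "sgn v * - k \<le> C" if "\<bar>k\<bar> \<le> C" for k v :: real
    using that \<open>C \<ge> 0\<close> by (auto simp: sgn_if)
  have "\<bar>y r\<bar> \<le> \<bar>y z\<bar> + C * (r - z)"
    by (rule abs_growth[where y' = y'])
       (use z y y' sg \<open>C \<ge> 0\<close> in \<open>auto elim: continuous_on_subset\<close>)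
  moreover have "\<bar>y (- (- s))\<bar> \<le> \<bar>y (- (- z))\<bar> + C * (- s - (- z))"
  proof (rule abs_growth[where y = "\<lambda>x. y (- x)" and y' = "\<lambda>t. - y' (- t)" and s = "- z" and r = "- s"])
    show "continuous_on {- z..- s} (\<lambda>x. y (- x))"
      by (rule continuous_on_compose2[OF y]) (use z in \<open>auto intro!: continuous_intros\<close>)
    fix t assume t: "- z < t" "t < - s" "y (- t) \<noteq> 0"
    then have "(y has_real_derivative y' (- t)) (at (- t))" "\<bar>y' (- t)\<bar> \<le> C"
      using y'[of "- t"] z by auto
    moreover from this(1) have "((\<lambda>x. y (- x)) has_real_derivative y' (- t) * - 1) (at t)"
      by (rule DERIV_chain2) (auto intro!: derivative_eq_intros)
    ultimately show "((\<lambda>x. y (- x)) has_real_derivative - y' (- t)) (at t) \<and> sgn (y (- t)) * - y' (- t) \<le> C"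
      using sg(2) by simp
  qed (use z \<open>C \<ge> 0\<close> in auto)
  ultimately show ?thesis using z by (simp add: algebra_simps)
next
  case False
  show ?thesis
  proof (cases "s < r")
    case True
    have "\<exists>l x. s < x \<and> x < r \<and> (y has_real_derivative l) (at x) \<and> y r - y s = (r - s) * l"
      using y' False by (intro MVT[OF True y]) (force simp: real_differentiable_def)
    then obtain l x where x: "s < x" "x < r" "(y has_real_derivative l) (at x)" "y r - y s = (r - s) * l"
      by blast
    note x(1,2)
    moreover have "y x \<noteq> 0" using False x by auto
    ultimately have "(y has_real_derivative y' x) (at x)" "\<bar>y' x\<bar> \<le> C" using y'[of x] by auto
    with DERIV_unique[OF x(3)] have "\<bar>l\<bar> \<le> C" by simp
    then show ?thesis using x(4) True by (simp add: abs_mult mult.commute)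
  qed (use assms in auto)
qed

text \<open>The function \<open>y = signed_powr (1 + \<alpha>) b\<close> has the derivative \<open>(1 + \<alpha>) * \<bar>b\<bar> powr \<alpha> * b'\<close> off its zeros, so it is
  Lipschitz. Inverting the power costs the exponent \<open>1 / (1 + \<alpha>)\<close>, and this is where the
  exponent of the theorem comes from.\<close>

lemma holder_of_bounded_curvature:
  fixes b b' :: "real \<Rightarrow> real"
  assumes \<alpha>: "\<alpha> \<ge> 0" and C: "C \<ge> 0" and "s \<le> t" and b: "continuous_on {s..t} b"
    and b': "\<And>r. s < r \<Longrightarrow> r < t \<Longrightarrow> b r \<noteq> 0 \<Longrightarrow>
        (b has_real_derivative b' r) (at r) \<and> \<bar>b r\<bar> powr \<alpha> * \<bar>b' r\<bar> \<le> C"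
  shows "\<bar>b s - b t\<bar> \<le> 2 * ((1 + \<alpha>) * C) powr (1 / (1 + \<alpha>)) * \<bar>s - t\<bar> powr (1 / (1 + \<alpha>))"
proof -
  define y where "y = (\<lambda>r. signed_powr (1 + \<alpha>) (b r))"
  define \<beta> where "\<beta> = 1 / (1 + \<alpha>)"
  have \<beta>: "0 < \<beta>" "\<beta> \<le> 1" using \<alpha> by (auto simp: \<beta>_def)
  have "\<bar>y t - y s\<bar> \<le> (1 + \<alpha>) * C * (t - s)"
  proof (rule lipschitz_off_zeros[where y' = "\<lambda>r. (1 + \<alpha>) * \<bar>b r\<bar> powr \<alpha> * b' r"])
    show "continuous_on {s..t} y" unfolding y_def using \<alpha> by (intro continuous_intros b) auto
    fix r assume r: "s < r" "r < t" "y r \<noteq> 0"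
    then have "b r \<noteq> 0" by (simp add: y_def)
    from b'[OF r(1,2) this] have d: "(b has_real_derivative b' r) (at r)"
      and le: "\<bar>b r\<bar> powr \<alpha> * \<bar>b' r\<bar> \<le> C" by auto
    have "(y has_real_derivative (1 + \<alpha>) * \<bar>b r\<bar> powr \<alpha> * b' r) (at r)"
      unfolding y_def
      using DERIV_chain2[where f = "signed_powr (1 + \<alpha>)" and g = b,
          OF has_real_derivative_signed_powr[OF \<open>b r \<noteq> 0\<close>, of "1 + \<alpha>"] d] by simp
    moreover have "(1 + \<alpha>) * (\<bar>b r\<bar> powr \<alpha> * \<bar>b' r\<bar>) \<le> (1 + \<alpha>) * C"
      using le \<alpha> by (intro mult_left_mono) auto
    ultimately show "(y has_real_derivative (1 + \<alpha>) * \<bar>b r\<bar> powr \<alpha> * b' r) (at r) \<and>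
        \<bar>(1 + \<alpha>) * \<bar>b r\<bar> powr \<alpha> * b' r\<bar> \<le> (1 + \<alpha>) * C"
      using \<alpha> by (simp add: abs_mult mult.assoc)
  qed (use assms in auto)
  moreover have "b r = signed_powr \<beta> (y r)" for r
    using \<alpha> by (simp add: y_def \<beta>_def signed_powr_signed_powr)
  ultimately have "\<bar>b s - b t\<bar> \<le> 2 * ((1 + \<alpha>) * C * (t - s)) powr \<beta>"
    using signed_powr_holder[OF \<beta>, of "y s" "y t"] \<beta> powr_mono2[of \<beta> "\<bar>y s - y t\<bar>" "(1 + \<alpha>) * C * (t - s)"]
    by (simp add: abs_minus_commute)
  also have "(1 + \<alpha>) * C * (t - s) = (1 + \<alpha>) * C * \<bar>s - t\<bar>" using \<open>s \<le> t\<close> by simp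
  also have "2 * (\<dots>) powr \<beta> = 2 * ((1 + \<alpha>) * C) powr \<beta> * \<bar>s - t\<bar> powr \<beta>"
    using \<alpha> C by (subst powr_mult) auto
  finally show ?thesis by (simp add: \<beta>_def)
qed

section \<open>The radial equation on an interval\<close>

lemma continuous_on_Icc_bound:
  fixes h :: "real \<Rightarrow> real"
  assumes "continuous_on {p..q} h"
  obtains B where "B \<ge> 0" "\<And>r. r \<in> {p..q} \<Longrightarrow> \<bar>h r\<bar> \<le> B"
proof -
  have "bounded (h ` {p..q})" using assms by (intro compact_imp_bounded compact_continuous_image) auto
  then obtain B where "B > 0" "\<forall>x\<in>h ` {p..q}. norm x \<le> B" by (auto simp: bounded_pos)
  then show ?thesis by (intro that[of B]) auto
qed

text \<open>The equation \<open>\<bar>u'\<bar> powr \<alpha> * G r u'' (u' / r) = f r\<close> in the viscosity sense, tested only with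
  nonzero slopes \<open>b\<close>. The monotonicity and sign assumptions on \<open>G\<close> are what remains of uniform ellipticity for
  Hessians that have the eigenvalue \<open>d\<close> in the radial direction and \<open>q\<close> in all directions orthogonal to it. Those on
  the sign of \<open>G r 0 q\<close> are used near \<open>r = 0\<close>, where \<open>q = b / r\<close> is unbounded.\<close>

locale radial_equation =
  fixes lo hi \<alpha> a c :: real and G :: "real \<Rightarrow> real \<Rightarrow> real \<Rightarrow> real" and f u :: "real \<Rightarrow> real"
  assumes lo: "0 \<le> lo" and \<alpha>: "\<alpha> \<ge> 0" and a: "a > 0" and c: "c \<ge> 0"
    and G_mono: "\<And>r d d' q. r \<in> {lo<..<hi} \<Longrightarrow> d \<le> d' \<Longrightarrow> a * (d' - d) \<le> G r d' q - G r d q"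
    and G_pos: "\<And>r q. r \<in> {lo<..<hi} \<Longrightarrow> q \<ge> 0 \<Longrightarrow> 0 \<le> G r 0 q \<and> G r 0 q \<le> c * q"
    and G_neg: "\<And>r q. r \<in> {lo<..<hi} \<Longrightarrow> q \<le> 0 \<Longrightarrow> c * q \<le> G r 0 q \<and> G r 0 q \<le> 0"
    and G_cont: "continuous_on ({lo<..<hi} \<times> UNIV \<times> UNIV) (\<lambda>(r, d, q). G r d q)"
    and f_cont: "continuous_on {lo<..<hi} f"
    and u_cont: "continuous_on {lo<..<hi} u"
    and sub: "\<And>r b d. r \<in> {lo<..<hi} \<Longrightarrow> b \<noteq> 0 \<Longrightarrow> subjet u r b d \<Longrightarrow>
        \<bar>b\<bar> powr \<alpha> * G r d (b / r) \<le> f r"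
    and super: "\<And>r b d. r \<in> {lo<..<hi} \<Longrightarrow> b \<noteq> 0 \<Longrightarrow> subjet (\<lambda>s. - u s) r b d \<Longrightarrow>
        f r \<le> \<bar>b\<bar> powr \<alpha> * G r (- d) (- b / r)"
begin

lemma G_abs: "r \<in> {lo<..<hi} \<Longrightarrow> \<bar>G r 0 q\<bar> \<le> c * \<bar>q\<bar>"
  using G_pos[of r q] G_neg[of r q] by (cases "q \<ge> 0") (auto simp: abs_if)

lemma G_less: "r \<in> {lo<..<hi} \<Longrightarrow> d < d' \<Longrightarrow> G r d q < G r d' q"
  using G_mono[of r d d' q] a by (smt (verit) mult_pos_pos)

lemma G_le_iff: "r \<in> {lo<..<hi} \<Longrightarrow> G r d q \<le> G r d' q \<longleftrightarrow> d \<le> d'"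
  using G_less[of r d d' q] G_less[of r d' d q] by (cases d d' rule: linorder_cases) auto

lemma G_cont_d: "r \<in> {lo<..<hi} \<Longrightarrow> continuous_on UNIV (\<lambda>d. G r d q)"
  by (rule continuous_on_compose2[OF G_cont, where f = "\<lambda>d. (r, d, q)", simplified])
     (auto intro!: continuous_intros)

lemma G_surj:
  assumes r: "r \<in> {lo<..<hi}"
  shows "\<exists>d. G r d q = k"
proof -
  define m where "m = (\<bar>k\<bar> + c * \<bar>q\<bar>) / a"
  have m: "m \<ge> 0" "a * m = \<bar>k\<bar> + c * \<bar>q\<bar>" using a c by (auto simp: m_def)
  have "G r (- m) q \<le> k" using G_mono[OF r, of "- m" 0 q] G_abs[OF r, of q] m by auto
  moreover have "k \<le> G r m q" using G_mono[OF r, of 0 m q] G_abs[OF r, of q] m by auto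
  ultimately show ?thesis
    using IVT'[of "\<lambda>d. G r d q" "- m" k m] m(1) continuous_on_subset[OF G_cont_d[OF r, of q]] by auto
qed

text \<open>The equation solved for the second derivative; for slope \<open>0\<close> the value is arbitrary.\<close>

definition curv :: "real \<Rightarrow> real \<Rightarrow> real" where
  "curv r b = (SOME d. \<bar>b\<bar> powr \<alpha> * G r d (b / r) = f r)"

lemma curv_eq:
  assumes "r \<in> {lo<..<hi}" "b \<noteq> 0"
  shows "\<bar>b\<bar> powr \<alpha> * G r (curv r b) (b / r) = f r"
proof -
  obtain d where "G r d (b / r) = f r / \<bar>b\<bar> powr \<alpha>" using G_surj[OF assms(1)] by blast
  then have "\<bar>b\<bar> powr \<alpha> * G r d (b / r) = f r" using assms(2) by simp
  then show ?thesis unfolding curv_def by (rule someI)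
qed

lemma le_curv_iff:
  assumes "r \<in> {lo<..<hi}" "b \<noteq> 0"
  shows "\<bar>b\<bar> powr \<alpha> * G r d (b / r) \<le> f r \<longleftrightarrow> d \<le> curv r b"
    and "f r \<le> \<bar>b\<bar> powr \<alpha> * G r d (b / r) \<longleftrightarrow> curv r b \<le> d"
  using assms(2) unfolding curv_eq[OF assms, symmetric]
  by (simp_all add: G_le_iff[OF assms(1)])

lemma subjet_curv:
  assumes "r \<in> {lo<..<hi}" "b \<noteq> 0"
  shows "subjet u r b d \<Longrightarrow> d \<le> curv r b"
    and "subjet (\<lambda>s. - u s) r (- b) d \<Longrightarrow> d \<le> - curv r b"
  using sub[OF assms, of d] super[OF assms(1), of "- b" d] assms(2)
    le_curv_iff[OF assms, of d] le_curv_iff(2)[OF assms, of "- d"] by auto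

lemma curv_bound:
  assumes r: "r \<in> {lo<..<hi}" and b: "b \<noteq> 0"
  shows "a * \<bar>curv r b\<bar> \<le> c * (\<bar>b\<bar> / r) + \<bar>f r\<bar> * \<bar>b\<bar> powr (- \<alpha>)"
proof -
  have p: "\<bar>b\<bar> powr \<alpha> > 0" using b by simp
  have eq: "G r (curv r b) (b / r) = f r * \<bar>b\<bar> powr (- \<alpha>)"
    using curv_eq[OF assms] p by (simp add: powr_minus field_simps)
  then have "\<bar>G r (curv r b) (b / r)\<bar> = \<bar>f r\<bar> * \<bar>b\<bar> powr (- \<alpha>)" by (simp add: abs_mult)
  moreover have "\<bar>G r 0 (b / r)\<bar> \<le> c * (\<bar>b\<bar> / r)" using G_abs[OF r, of "b / r"] r lo by simp
  ultimately show ?thesis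
    using G_mono[OF r, of 0 "curv r b" "b / r"] G_mono[OF r, of "curv r b" 0 "b / r"]
    by (cases "curv r b \<ge> 0") auto
qed

text \<open>In the direction that increases \<open>\<bar>u'\<bar>\<close>, the term with \<open>b / r\<close> has the favourable sign and drops
  out of the estimate. Hence the bound does not deteriorate at \<open>r = 0\<close>.\<close>

lemma curv_bound_outward:
  assumes r: "r \<in> {lo<..<hi}" and b: "b \<noteq> 0"
  shows "a * (sgn b * curv r b) \<le> \<bar>f r\<bar> * \<bar>b\<bar> powr (- \<alpha>)"
proof -
  have p: "\<bar>b\<bar> powr \<alpha> > 0" using b by simp
  have "G r (curv r b) (b / r) = f r * \<bar>b\<bar> powr (- \<alpha>)"
    using curv_eq[OF assms] p by (simp add: powr_minus field_simps)
  then have eq: "\<bar>G r (curv r b) (b / r)\<bar> = \<bar>f r\<bar> * \<bar>b\<bar> powr (- \<alpha>)" by (simp add: abs_mult)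
  show ?thesis
  proof (cases "sgn b * curv r b \<le> 0")
    case True
    then have "a * (sgn b * curv r b) \<le> 0" using a by (simp add: mult_le_0_iff)
    also have "0 \<le> \<bar>f r\<bar> * \<bar>b\<bar> powr (- \<alpha>)" by simp
    finally show ?thesis .
  next
    case False
    show ?thesis
    proof (cases "b > 0")
      case True
      then have "curv r b > 0" "b / r \<ge> 0" using False r lo by auto
      then show ?thesis using G_mono[OF r, of 0 "curv r b" "b / r"] G_pos[OF r, of "b / r"] eq True by auto
    next
      case bF: False
      then have "curv r b < 0" "b / r \<le> 0" using False b r lo by (auto simp: divide_nonpos_pos)
      then show ?thesis using G_mono[OF r, of "curv r b" 0 "b / r"] G_neg[OF r, of "b / r"] eq b bF by auto
    qed
  qed
qed

text \<open>By monotonicity in \<open>d\<close>, a strict inequality \<open>k < curv r b\<close> is a strict inequality between continuous functions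
  of \<open>r\<close> and \<open>b\<close>, hence stable.\<close>

lemma isCont_curv:
  assumes r: "r \<in> {lo<..<hi}" and h: "isCont h r" "h r \<noteq> 0"
  shows "isCont (\<lambda>s. curv s (h s)) r"
proof -
  have ev: "\<forall>\<^sub>F s in at r. s \<in> {lo<..<hi} \<and> h s \<noteq> 0"
    using r h by (intro eventually_conj eventually_at_in_open' tendsto_imp_eventually_ne) (auto simp: isCont_def)
  have lim: "((\<lambda>s. \<bar>h s\<bar> powr \<alpha> * G s d (h s / s)) \<longlongrightarrow> \<bar>h r\<bar> powr \<alpha> * G r d (h r / r)) (at r)" for d
  proof -
    have h': "(h \<longlongrightarrow> h r) (at r)" using h by (simp add: isCont_def)
    have "isCont (\<lambda>(r, d, q). G r d q) (r, d, h r / r)"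
      using G_cont r by (subst (asm) continuous_on_eq_continuous_at) (auto intro!: open_Times)
    then have "((\<lambda>s. case (s, d, h s / s) of (r, d, q) \<Rightarrow> G r d q) \<longlongrightarrow> (case (r, d, h r / r) of (r, d, q) \<Rightarrow> G r d q)) (at r)"
      by (rule isCont_tendsto_compose) (use r lo in \<open>auto intro!: tendsto_intros h'\<close>)
    then show ?thesis using h(2) by (auto intro!: tendsto_intros h')
  qed
  have flim: "(f \<longlongrightarrow> f r) (at r)"
    using f_cont r by (simp add: continuous_on_eq_continuous_at isCont_def)
  show ?thesis
    unfolding isCont_def
  proof (rule order_tendstoI)
    fix k assume "k < curv r (h r)"
    then have "\<bar>h r\<bar> powr \<alpha> * G r k (h r / r) < f r"
      using le_curv_iff(2)[OF r h(2), of k] by auto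
    then have "\<forall>\<^sub>F s in at r. 0 < f s - \<bar>h s\<bar> powr \<alpha> * G s k (h s / s)"
      by (intro order_tendstoD(1)[OF tendsto_diff[OF flim lim]]) simp
    then show "\<forall>\<^sub>F s in at r. k < curv s (h s)"
      using ev by eventually_elim (use le_curv_iff(2) in \<open>force simp: not_le[symmetric]\<close>)
  next
    fix k assume "curv r (h r) < k"
    then have "f r < \<bar>h r\<bar> powr \<alpha> * G r k (h r / r)"
      using le_curv_iff(1)[OF r h(2), of k] by auto
    then have "\<forall>\<^sub>F s in at r. 0 < \<bar>h s\<bar> powr \<alpha> * G s k (h s / s) - f s"
      by (intro order_tendstoD(1)[OF tendsto_diff[OF lim flim]]) simp
    then show "\<forall>\<^sub>F s in at r. curv s (h s) < k"
      using ev by eventually_elim (use le_curv_iff(1) in \<open>force simp: not_le[symmetric]\<close>)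
  qed
qed


text \<open>Away from \<open>r = 0\<close> the curvature of jets is bounded by a multiple of \<open>\<bar>b\<bar> + \<bar>b\<bar> powr (- \<alpha>)\<close>, so the
  secant estimate applies to \<open>u\<close> and to \<open>- u\<close>.\<close>

lemma u_C1:
  assumes r0: "r0 \<in> {lo<..<hi}"
  shows "(u has_real_derivative deriv u r0) (at r0)" "isCont (deriv u) r0"
proof -
  define lo' where "lo' = (lo + r0) / 2"
  define hi' where "hi' = (r0 + hi) / 2"
  have ends: "lo < lo'" "0 < lo'" "lo' < r0" "r0 < hi'" "hi' < hi"
    using r0 lo by (auto simp: lo'_def hi'_def)
  then have J: "r \<in> {lo<..<hi}" if "r \<in> {lo'..hi'}" for r using that by auto
  obtain B where "0 \<le> B" and B: "\<And>r. r \<in> {lo'..hi'} \<Longrightarrow> \<bar>f r\<bar> \<le> B"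
    using continuous_on_Icc_bound[OF continuous_on_subset[OF f_cont]] J by blast
  define C where "C = (c / lo' + B) / a"
  have C: "C \<ge> 0" using c a ends \<open>0 \<le> B\<close> by (simp add: C_def)
  have bound: "\<bar>curv r b\<bar> \<le> C * (\<bar>b\<bar> + \<bar>b\<bar> powr (- \<alpha>))" if r: "r \<in> {lo'..hi'}" and b: "b \<noteq> 0" for r b
  proof -
    have "a * \<bar>curv r b\<bar> \<le> c * (\<bar>b\<bar> / r) + \<bar>f r\<bar> * \<bar>b\<bar> powr (- \<alpha>)"
      by (rule curv_bound[OF J[OF r] b])
    also have "\<dots> \<le> c * (\<bar>b\<bar> / lo') + B * \<bar>b\<bar> powr (- \<alpha>)"
      using r ends c B[OF r] by (intro add_mono mult_left_mono mult_right_mono divide_left_mono) auto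
    also have "\<dots> \<le> (c / lo' + B) * (\<bar>b\<bar> + \<bar>b\<bar> powr (- \<alpha>))"
      using c ends \<open>0 \<le> B\<close> by (simp add: distrib_left distrib_right)
    also have "\<dots> = a * (C * (\<bar>b\<bar> + \<bar>b\<bar> powr (- \<alpha>)))" using a by (simp add: C_def)
    finally show ?thesis using a by simp
  qed
  define L where "L = (1 + \<alpha>) * C + 1"
  have L: "L > 0" "(1 + \<alpha>) * C < L" using C \<alpha> by (auto simp: L_def add_nonneg_pos)
  obtain u' where u': "\<And>r. r \<in> {lo'<..<hi'} \<Longrightarrow> (u has_real_derivative u' r) (at r)"
    "continuous_on {lo'<..<hi'} u'"
  proof (rule C1_of_secant_levels[OF \<alpha>, of "3 * L" lo' hi' u])
    fix p m q assume pmq: "lo' < p" "p < m" "m < q" "q < hi'"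
    have cont: "continuous_on {p..q} u"
      using pmq J by (intro continuous_on_subset[OF u_cont]) auto
    have 1: "level \<alpha> (secant u m q) \<le> level \<alpha> (secant u p m) + 3 * L * (q - p)"
    proof (rule secant_level_bound[OF \<alpha> L pmq(2,3) cont])
      fix r b d assume "p < r" "r < q" "b \<noteq> 0" "subjet u r b d"
      then show "d \<le> C * (\<bar>b\<bar> + \<bar>b\<bar> powr (- \<alpha>))"
        using subjet_curv(1)[OF J, of r b d] bound[of r b] pmq by auto
    qed
    have 2: "level \<alpha> (secant (\<lambda>s. - u s) m q) \<le> level \<alpha> (secant (\<lambda>s. - u s) p m) + 3 * L * (q - p)"
    proof (rule secant_level_bound[OF \<alpha> L pmq(2,3)])
      show "continuous_on {p..q} (\<lambda>s. - u s)" by (intro continuous_intros cont)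
      fix r b d assume "p < r" "r < q" "b \<noteq> 0" "subjet (\<lambda>s. - u s) r b d"
      then show "d \<le> C * (\<bar>b\<bar> + \<bar>b\<bar> powr (- \<alpha>))"
        using subjet_curv(2)[OF J, of r "- b" d] bound[of r "- b"] pmq by auto
    qed
    show "\<bar>level \<alpha> (secant u m q) - level \<alpha> (secant u p m)\<bar> \<le> 3 * L * (q - p)"
      using 1 2 unfolding secant_minus level_minus by linarith
  qed (use L in auto)
  have eq: "deriv u r = u' r" if "r \<in> {lo'<..<hi'}" for r
    using u'(1)[OF that] by (rule DERIV_imp_deriv)
  have r0': "r0 \<in> {lo'<..<hi'}" using ends by auto
  then show "(u has_real_derivative deriv u r0) (at r0)" using u'(1) eq by simp
  have "continuous_on {lo'<..<hi'} (deriv u) \<longleftrightarrow> continuous_on {lo'<..<hi'} u'"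
    by (rule continuous_on_cong) (simp_all add: eq)
  then have "continuous_on {lo'<..<hi'} (deriv u)" using u'(2) by simp
  then show "isCont (deriv u) r0" using r0' by (simp add: continuous_on_eq_continuous_at)
qed

lemma continuous_on_deriv_u: "S \<subseteq> {lo<..<hi} \<Longrightarrow> continuous_on S (deriv u)"
  using u_C1(2) by (intro continuous_at_imp_continuous_on) auto

lemma deriv_u_ode:
  assumes r: "r \<in> {lo<..<hi}" and "deriv u r \<noteq> 0"
  shows "(deriv u has_real_derivative curv r (deriv u r)) (at r)"
proof (rule has_derivative_of_subjets[where J = "{lo<..<hi} \<inter> deriv u -` (- {0})" and w = u])
  show "open ({lo<..<hi} \<inter> deriv u -` (- {0}))"
    by (intro continuous_open_preimage continuous_on_deriv_u) auto
  show "isCont (\<lambda>s. curv s (deriv u s)) r" by (rule isCont_curv[OF r u_C1(2)[OF r] assms(2)])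
qed (use assms u_C1(1) subjet_curv in auto)

text \<open>The assumption involving \<open>Y\<close> compensates the factor \<open>1 / r\<close> in the bound for the curvature. It holds with a
  uniform \<open>Y\<close> on compact subintervals and, less obviously, up to \<open>r = 0\<close>.\<close>

lemma deriv_u_holder:
  assumes "s \<le> t" "{s..t} \<subseteq> {lo<..<hi}"
    and B: "\<And>r. r \<in> {s..t} \<Longrightarrow> \<bar>f r\<bar> \<le> B"
    and Y: "Y \<ge> 0" "\<And>r. r \<in> {s..t} \<Longrightarrow> \<bar>deriv u r\<bar> powr (1 + \<alpha>) \<le> Y * r"
  shows "\<bar>deriv u s - deriv u t\<bar> \<le>
    2 * ((1 + \<alpha>) * ((c * Y + B) / a)) powr (1 / (1 + \<alpha>)) * \<bar>s - t\<bar> powr (1 / (1 + \<alpha>))"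
proof (rule holder_of_bounded_curvature[OF \<alpha> _ \<open>s \<le> t\<close>, where b' = "\<lambda>r. curv r (deriv u r)"])
  have "0 \<le> B" using B[of s] \<open>s \<le> t\<close> by force
  then show "0 \<le> (c * Y + B) / a" using c Y a by simp
  show "continuous_on {s..t} (deriv u)" by (rule continuous_on_deriv_u[OF assms(2)])
  fix r assume r: "s < r" "r < t" "deriv u r \<noteq> 0"
  then have rst: "r \<in> {s..t}" by simp
  then have rJ: "r \<in> {lo<..<hi}" using assms(2) by blast
  define b where "b = deriv u r"
  have b: "b \<noteq> 0" "\<bar>b\<bar> powr (1 + \<alpha>) \<le> Y * r" using r Y(2)[OF rst] by (auto simp: b_def)
  have "r > 0" using rJ lo by simp
  have "a * (\<bar>b\<bar> powr \<alpha> * \<bar>curv r b\<bar>) = \<bar>b\<bar> powr \<alpha> * (a * \<bar>curv r b\<bar>)" by simp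
  also have "\<dots> \<le> \<bar>b\<bar> powr \<alpha> * (c * (\<bar>b\<bar> / r) + \<bar>f r\<bar> * \<bar>b\<bar> powr (- \<alpha>))"
    by (intro mult_left_mono curv_bound[OF rJ b(1)]) auto
  also have "\<dots> = c * (\<bar>b\<bar> powr (1 + \<alpha>) / r) + \<bar>f r\<bar>"
    using b(1) by (simp add: powr_add powr_minus field_simps)
  also have "\<dots> \<le> c * Y + B"
    using b(2) \<open>r > 0\<close> c B[OF rst] by (intro add_mono mult_left_mono) (auto simp: divide_le_eq)
  finally have "\<bar>b\<bar> powr \<alpha> * \<bar>curv r b\<bar> \<le> (c * Y + B) / a" using a by (simp add: field_simps)
  then show "(deriv u has_real_derivative curv r (deriv u r)) (at r) \<and>
      \<bar>deriv u r\<bar> powr \<alpha> * \<bar>curv r (deriv u r)\<bar> \<le> (c * Y + B) / a"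
    using deriv_u_ode[OF rJ r(3)] by (simp add: b_def)
qed

lemma deriv_u_locally_holder:
  assumes r0: "r0 \<in> {lo<..<hi}"
  shows "\<exists>\<epsilon>>0. ball r0 \<epsilon> \<subseteq> {lo<..<hi} \<and> (\<exists>C. \<forall>s\<in>ball r0 \<epsilon>. \<forall>t\<in>ball r0 \<epsilon>.
    \<bar>deriv u s - deriv u t\<bar> \<le> C * \<bar>s - t\<bar> powr (1 / (1 + \<alpha>)))"
proof -
  obtain \<epsilon> where \<epsilon>: "\<epsilon> > 0" "cball r0 \<epsilon> \<subseteq> {lo<..<hi}"
    using r0 by (metis open_contains_cball open_greaterThanLessThan)
  have pos: "r0 - \<epsilon> > 0" "{r0 - \<epsilon>..r0 + \<epsilon>} \<subseteq> {lo<..<hi}"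
  proof -
    show "{r0 - \<epsilon>..r0 + \<epsilon>} \<subseteq> {lo<..<hi}" using \<epsilon>(2) by (simp add: cball_eq_atLeastAtMost)
    then show "r0 - \<epsilon> > 0" using \<epsilon>(1) lo by force
  qed
  define K where "K = {r0 - \<epsilon>..r0 + \<epsilon>}"
  obtain B where B: "\<And>r. r \<in> K \<Longrightarrow> \<bar>f r\<bar> \<le> B"
    using continuous_on_Icc_bound[OF continuous_on_subset[OF f_cont pos(2)]] unfolding K_def by blast
  obtain D where D: "\<And>r. r \<in> K \<Longrightarrow> \<bar>deriv u r\<bar> \<le> D"
    using continuous_on_Icc_bound[OF continuous_on_deriv_u[OF pos(2)]] unfolding K_def by blast
  define Y where "Y = D powr (1 + \<alpha>) / (r0 - \<epsilon>)"
  have Y: "Y \<ge> 0" "\<And>r. r \<in> K \<Longrightarrow> \<bar>deriv u r\<bar> powr (1 + \<alpha>) \<le> Y * r"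
  proof -
    show "Y \<ge> 0" using pos by (simp add: Y_def)
    fix r assume r: "r \<in> K"
    have "\<bar>deriv u r\<bar> powr (1 + \<alpha>) \<le> D powr (1 + \<alpha>)" using D[OF r] \<alpha> by (intro powr_mono2) auto
    also have "\<dots> = Y * (r0 - \<epsilon>)" using pos by (simp add: Y_def)
    also have "\<dots> \<le> Y * r" using r \<open>Y \<ge> 0\<close> by (intro mult_left_mono) (auto simp: K_def)
    finally show "\<bar>deriv u r\<bar> powr (1 + \<alpha>) \<le> Y * r" .
  qed
  define C where "C = 2 * ((1 + \<alpha>) * ((c * Y + B) / a)) powr (1 / (1 + \<alpha>))"
  have le: "\<bar>deriv u s - deriv u t\<bar> \<le> C * \<bar>s - t\<bar> powr (1 / (1 + \<alpha>))"
    if "s \<in> K" "t \<in> K" "s \<le> t" for s t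
  proof -
    have "{s..t} \<subseteq> K" using that by (auto simp: K_def)
    then show ?thesis unfolding C_def using pos(2) B Y that(3)
      by (intro deriv_u_holder) (auto simp: K_def)
  qed
  have "\<bar>deriv u s - deriv u t\<bar> \<le> C * \<bar>s - t\<bar> powr (1 / (1 + \<alpha>))"
    if "s \<in> ball r0 \<epsilon>" "t \<in> ball r0 \<epsilon>" for s t
  proof -
    have "s \<in> K" "t \<in> K" using that by (auto simp: K_def dist_real_def)
    then show ?thesis using le[of s t] le[of t s] by (cases "s \<le> t") (auto simp: abs_minus_commute)
  qed
  then show ?thesis using \<epsilon> ball_subset_cball[of r0 \<epsilon>] by blast
qed

lemma deriv_u_growth:
  assumes "s \<le> r" "{s..r} \<subseteq> {lo<..<hi}"
    and B: "\<And>t. t \<in> {s..r} \<Longrightarrow> \<bar>f t\<bar> \<le> B"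
  shows "\<bar>deriv u r\<bar> powr (1 + \<alpha>) \<le> \<bar>deriv u s\<bar> powr (1 + \<alpha>) + (1 + \<alpha>) * B / a * (r - s)"
proof -
  define y where "y = (\<lambda>t. signed_powr (1 + \<alpha>) (deriv u t))"
  have "0 \<le> B" using B[of s] \<open>s \<le> r\<close> by force
  have "\<bar>y r\<bar> \<le> \<bar>y s\<bar> + (1 + \<alpha>) * B / a * (r - s)"
  proof (rule abs_growth[where y' = "\<lambda>t. (1 + \<alpha>) * \<bar>deriv u t\<bar> powr \<alpha> * curv t (deriv u t)"])
    show "0 \<le> (1 + \<alpha>) * B / a" using \<alpha> a \<open>0 \<le> B\<close> by simp
    show "continuous_on {s..r} y"
      unfolding y_def using \<alpha> by (intro continuous_intros continuous_on_deriv_u assms) auto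
    fix t assume t: "s < t" "t < r" "y t \<noteq> 0"
    then have b0: "deriv u t \<noteq> 0" and tsr: "t \<in> {s..r}" by (auto simp: y_def)
    then have tJ: "t \<in> {lo<..<hi}" using assms(2) by blast
    define b where "b = deriv u t"
    have b: "b \<noteq> 0" using b0 by (simp add: b_def)
    have "(y has_real_derivative (1 + \<alpha>) * \<bar>b\<bar> powr \<alpha> * curv t b) (at t)"
      unfolding y_def b_def
      using DERIV_chain2[where f = "signed_powr (1 + \<alpha>)" and g = "deriv u",
          OF has_real_derivative_signed_powr[OF b0, of "1 + \<alpha>"] deriv_u_ode[OF tJ b0]] by simp
    moreover have "sgn (y t) * ((1 + \<alpha>) * \<bar>b\<bar> powr \<alpha> * curv t b) \<le> (1 + \<alpha>) * B / a"
    proof -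
      have "a * (sgn b * curv t b) * \<bar>b\<bar> powr \<alpha> \<le> \<bar>f t\<bar> * \<bar>b\<bar> powr (- \<alpha>) * \<bar>b\<bar> powr \<alpha>"
        by (intro mult_right_mono curv_bound_outward[OF tJ b]) auto
      also have "\<dots> = \<bar>f t\<bar>" using b by (simp add: powr_minus)
      also have "\<dots> \<le> B" by (rule B[OF tsr])
      finally have "sgn b * curv t b * \<bar>b\<bar> powr \<alpha> \<le> B / a" using a by (simp add: field_simps)
      then have "(1 + \<alpha>) * (sgn b * curv t b * \<bar>b\<bar> powr \<alpha>) \<le> (1 + \<alpha>) * (B / a)"
        using \<alpha> by (intro mult_left_mono) auto
      then show ?thesis by (simp add: y_def b_def mult_ac)
    qed
    ultimately show "(y has_real_derivative (1 + \<alpha>) * \<bar>deriv u t\<bar> powr \<alpha> * curv t (deriv u t)) (at t) \<and>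
        sgn (y t) * ((1 + \<alpha>) * \<bar>deriv u t\<bar> powr \<alpha> * curv t (deriv u t)) \<le> (1 + \<alpha>) * B / a"
      by (simp add: b_def)
  qed (use assms in auto)
  then show ?thesis by (simp add: y_def abs_signed_powr)
qed

text \<open>Otherwise \<open>u'\<close> has a constant sign and is bounded away from \<open>0\<close> near the origin, so \<open>u\<close>, as a function
  of \<open>\<bar>x\<bar>\<close>, lies above or below a cone with vertex at the origin.\<close>

lemma small_slopes_near_origin:
  assumes lo0: "lo = 0" and hi: "0 < hi"
    and u0: "continuous_on {0..<hi} u"
    and no_cone: "\<And>k. k > 0 \<Longrightarrow> \<not> (\<forall>\<^sub>F r in at_right 0. k * r \<le> u r - u 0)"
      "\<And>k. k > 0 \<Longrightarrow> \<not> (\<forall>\<^sub>F r in at_right 0. k * r \<le> u 0 - u r)"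
    and k: "k > 0" "\<delta> > 0"
  shows "\<exists>s. 0 < s \<and> s < \<delta> \<and> \<bar>deriv u s\<bar> < k"
proof (rule ccontr)
  assume "\<not> ?thesis"
  then have ge: "\<bar>deriv u s\<bar> \<ge> k" if "0 < s" "s < \<delta>" for s using that by force
  define \<eta> where "\<eta> = min \<delta> hi"
  have \<eta>: "\<eta> > 0" "\<eta> \<le> \<delta>" "\<eta> \<le> hi" using k hi by (auto simp: \<eta>_def)
  have mvt: "\<exists>z. 0 < z \<and> z < r \<and> u r - u 0 = r * deriv u z" if r: "0 < r" "r < \<eta>" for r
  proof -
    have "continuous_on {0..r} u" using r \<eta> by (intro continuous_on_subset[OF u0]) auto
    moreover have du: "(u has_real_derivative deriv u x) (at x)" if "0 < x" "x < r" for x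
      using u_C1(1)[of x] that r \<eta> lo0 by auto
    then have "u differentiable (at x)" if "0 < x" "x < r" for x
      using that by (auto simp: real_differentiable_def)
    ultimately obtain l z where z: "0 < z" "z < r" "(u has_real_derivative l) (at z)" "u r - u 0 = (r - 0) * l"
      using MVT[OF r(1), of u] by blast
    then have "l = deriv u z" using DERIV_unique du by blast
    with z show ?thesis by auto
  qed
  have ev: "\<forall>\<^sub>F r in at_right 0. 0 < r \<and> r < \<eta>"
    using \<eta>(1) eventually_at_right_less by (auto simp: eventually_at_right_field)
  have nz: "deriv u x \<noteq> 0" if "0 < x" "x < \<eta>" for x
    using ge[of x] that k \<eta> by auto
  have cont: "continuous_on {x..y} (deriv u)" if "0 < x" "y < \<eta>" for x y
    using that \<eta> lo0 by (intro continuous_on_deriv_u) auto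
  have "\<not> (deriv u x < 0 \<and> deriv u y > 0)" if "0 < x" "x < \<eta>" "0 < y" "y < \<eta>" for x y
  proof
    assume *: "deriv u x < 0 \<and> deriv u y > 0"
    have "\<exists>z. min x y \<le> z \<and> z \<le> max x y \<and> deriv u z = 0"
      using IVT'[of "deriv u" x 0 y] IVT2'[of "deriv u" x 0 y] cont[of x y] cont[of y x] * that
      by (cases "x \<le> y") auto
    then obtain z where z: "min x y \<le> z" "z \<le> max x y" "deriv u z = 0" by blast
    then have "0 < z" "z < \<eta>" using that by linarith+
    then show False using nz z by blast
  qed
  then consider "\<And>x. 0 < x \<Longrightarrow> x < \<eta> \<Longrightarrow> deriv u x > 0" | "\<And>x. 0 < x \<Longrightarrow> x < \<eta> \<Longrightarrow> deriv u x < 0"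
    using nz by (metis linorder_neqE)
  then show False
  proof cases
    case 1
    have "\<forall>\<^sub>F r in at_right 0. k * r \<le> u r - u 0"
      using ev
    proof eventually_elim
      case (elim r)
      then obtain z where z: "0 < z" "z < r" "u r - u 0 = r * deriv u z" using mvt by blast
      have "k \<le> deriv u z" using 1[of z] ge[of z] z elim \<eta> by auto
      then have "r * k \<le> r * deriv u z" using elim by (intro mult_left_mono) auto
      then show ?case using z by (simp add: mult.commute)
    qed
    then show False using no_cone(1)[OF k(1)] by blast
  next
    case 2
    have "\<forall>\<^sub>F r in at_right 0. k * r \<le> u 0 - u r"
      using ev
    proof eventually_elim
      case (elim r)
      then obtain z where z: "0 < z" "z < r" "u r - u 0 = r * deriv u z" using mvt by blast
      have "k \<le> - deriv u z" using 2[of z] ge[of z] z elim \<eta> by auto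
      then have "r * k \<le> r * - deriv u z" using elim by (intro mult_left_mono) auto
      then show ?case using z by (simp add: mult.commute)
    qed
    then show False using no_cone(2)[OF k(1)] by blast
  qed
qed

text \<open>Integrate the growth estimate from points \<open>s\<close> close to \<open>0\<close> with small slope.\<close>

lemma deriv_u_near_origin:
  assumes lo0: "lo = 0" and hi: "0 < hi"
    and u0: "continuous_on {0..<hi} u"
    and no_cone: "\<And>k. k > 0 \<Longrightarrow> \<not> (\<forall>\<^sub>F r in at_right 0. k * r \<le> u r - u 0)"
      "\<And>k. k > 0 \<Longrightarrow> \<not> (\<forall>\<^sub>F r in at_right 0. k * r \<le> u 0 - u r)"
    and \<rho>: "\<rho> < hi" "\<And>t. 0 < t \<Longrightarrow> t \<le> \<rho> \<Longrightarrow> \<bar>f t\<bar> \<le> B"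
    and r: "0 < r" "r \<le> \<rho>"
  shows "\<bar>deriv u r\<bar> powr (1 + \<alpha>) \<le> (1 + \<alpha>) * B / a * r"
proof (rule field_le_epsilon)
  fix e :: real assume "e > 0"
  define k where "k = e powr (1 / (1 + \<alpha>))"
  have k: "k > 0" "k powr (1 + \<alpha>) = e" using \<open>e > 0\<close> \<alpha> by (auto simp: k_def powr_powr)
  obtain s where s: "0 < s" "s < r" "\<bar>deriv u s\<bar> < k"
    using small_slopes_near_origin[OF lo0 hi u0 no_cone k(1) r(1)] by blast
  have "0 \<le> B" using \<rho>(2)[OF r] by linarith
  have "\<bar>deriv u r\<bar> powr (1 + \<alpha>) \<le> \<bar>deriv u s\<bar> powr (1 + \<alpha>) + (1 + \<alpha>) * B / a * (r - s)"
    using s r \<rho> lo0 by (intro deriv_u_growth) auto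
  also have "\<dots> \<le> e + (1 + \<alpha>) * B / a * r"
    unfolding k(2)[symmetric] using s \<alpha> a \<open>0 \<le> B\<close>
    by (intro add_mono powr_mono2 mult_left_mono) auto
  finally show "\<bar>deriv u r\<bar> powr (1 + \<alpha>) \<le> (1 + \<alpha>) * B / a * r + e" by simp
qed

end

section \<open>Test functions and radial Hessians\<close>

definition outer :: "real^'n \<Rightarrow> real^'n^'n" where
  "outer x = (\<chi> i j. x $ i * x $ j)"

lemma outer_mult_vec: "outer x *v h = (x \<bullet> h) *\<^sub>R x"
  by (simp add: vec_eq_iff outer_def matrix_vector_mult_def inner_vec_def sum_distrib_left sum_distrib_right mult_ac)


lemma trace_outer: "trace (outer x) = x \<bullet> x"
  by (simp add: outer_def trace_def inner_vec_def)

lemma trace_scaleR: "trace (k *\<^sub>R M) = k * trace M" for M :: "real^'n^'n"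
  by (simp add: trace_def sum_distrib_left)

lemma outer_scaleR: "outer (r *\<^sub>R x) = r\<^sup>2 *\<^sub>R outer x"
  by (simp add: outer_def vec_eq_iff power2_eq_square mult_ac)

lemma continuous_on_outer: "continuous_on S outer"
  unfolding outer_def by (intro continuous_intros)

text \<open>The Hessian of a radial function at a point in direction \<open>e\<close>: eigenvalue \<open>d\<close> on the line of the unit vector \<open>e\<close> and
  \<open>q\<close> on its orthogonal complement.\<close>

definition radial_hessian :: "real^'n \<Rightarrow> real \<Rightarrow> real \<Rightarrow> real^'n^'n" where
  "radial_hessian e d q = d *\<^sub>R outer e + q *\<^sub>R (mat 1 - outer e)"

lemma sym_matrices_algebra:
  "0 \<in> sym_matrices" "mat 1 \<in> sym_matrices" "outer e \<in> sym_matrices"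
  "M \<in> sym_matrices \<Longrightarrow> N \<in> sym_matrices \<Longrightarrow> M + N \<in> sym_matrices"
  "M \<in> sym_matrices \<Longrightarrow> N \<in> sym_matrices \<Longrightarrow> M - N \<in> sym_matrices"
  "M \<in> sym_matrices \<Longrightarrow> - M \<in> sym_matrices"
  "M \<in> sym_matrices \<Longrightarrow> k *\<^sub>R M \<in> sym_matrices"
  by (auto simp: sym_matrices_def transpose_def vec_eq_iff outer_def mat_def)

lemma radial_hessian_sym [simp]: "radial_hessian e d q \<in> sym_matrices"
  unfolding radial_hessian_def by (intro sym_matrices_algebra)

lemma continuous_on_radial_hessian:
  "continuous_on S g \<Longrightarrow> continuous_on S h \<Longrightarrow> continuous_on S (\<lambda>z. radial_hessian e (g z) (h z))"
  unfolding radial_hessian_def by (intro continuous_intros)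

lemma psd_scaleR: "k \<ge> 0 \<Longrightarrow> psd Q \<Longrightarrow> psd (k *\<^sub>R Q)"
  by (simp add: psd_def scaleR_matrix_vector_assoc[symmetric])

lemma psd_outer: "psd (outer x)"
  by (simp add: psd_def outer_mult_vec inner_commute)

lemma psd_outer_compl:
  fixes e :: "real^'n"
  assumes "norm e = 1"
  shows "psd (mat 1 - outer e)"
  unfolding psd_def
proof
  fix \<xi> :: "real^'n"
  note assms
  then have "(e \<bullet> \<xi>)\<^sup>2 \<le> \<xi> \<bullet> \<xi>"
    using Cauchy_Schwarz_ineq[of e \<xi>] by (simp add: norm_eq_1)
  then show "0 \<le> \<xi> \<bullet> ((mat 1 - outer e) *v \<xi>)"
    by (simp add: matrix_vector_mult_diff_rdistrib outer_mult_vec inner_diff_right inner_commute power2_eq_square)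
qed

lemma trace_outer_compl: "norm (e :: real^'n) = 1 \<Longrightarrow> trace (mat 1 - outer e) = real CARD('n) - 1"
  by (simp add: trace_sub trace_I trace_outer norm_eq_1)

lemma C2_quadratic:
  fixes \<Omega> :: "(real^'n) set"
  shows "C2_grad_hess \<Omega> (\<lambda>x. p \<bullet> x + K / 2 * (x \<bullet> x)) (\<lambda>x. p + K *\<^sub>R x) (\<lambda>x. K *\<^sub>R mat 1)"
  unfolding C2_grad_hess_def
proof (intro conjI ballI)
  fix x :: "real^'n"
  show "((\<lambda>x. p \<bullet> x + K / 2 * (x \<bullet> x)) has_derivative (\<lambda>h. (p + K *\<^sub>R x) \<bullet> h)) (at x)"
    by (rule derivative_eq_intros refl)+ (auto simp: fun_eq_iff inner_add_left inner_commute algebra_simps)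
  show "((\<lambda>x. p + K *\<^sub>R x) has_derivative (\<lambda>h. (K *\<^sub>R mat 1) *v h)) (at x)"
    by (rule derivative_eq_intros refl)+ (auto simp: fun_eq_iff scaleR_matrix_vector_assoc[symmetric])
qed (intro continuous_intros)

text \<open>Polynomials in \<open>x \<bullet> x\<close> are radial and, unlike most functions of the norm, smooth on all of space.\<close>

lemma C2_radial_quartic:
  fixes \<Omega> :: "(real^'n) set"
  shows "C2_grad_hess \<Omega> (\<lambda>x. B * (x \<bullet> x - k) + D / 2 * (x \<bullet> x - k)\<^sup>2)
     (\<lambda>x. (2 * B + 2 * D * (x \<bullet> x - k)) *\<^sub>R x)
     (\<lambda>x. (2 * B + 2 * D * (x \<bullet> x - k)) *\<^sub>R mat 1 + (4 * D) *\<^sub>R outer x)"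
  unfolding C2_grad_hess_def
proof (intro conjI ballI)
  fix x :: "real^'n"
  show "((\<lambda>x. B * (x \<bullet> x - k) + D / 2 * (x \<bullet> x - k)\<^sup>2) has_derivative
      (\<lambda>h. ((2 * B + 2 * D * (x \<bullet> x - k)) *\<^sub>R x) \<bullet> h)) (at x)"
    by (rule derivative_eq_intros refl)+ (auto simp: fun_eq_iff inner_commute algebra_simps)
  show "((\<lambda>x. (2 * B + 2 * D * (x \<bullet> x - k)) *\<^sub>R x) has_derivative
      (\<lambda>h. ((2 * B + 2 * D * (x \<bullet> x - k)) *\<^sub>R mat 1 + (4 * D) *\<^sub>R outer x) *v h)) (at x)"
    by (rule derivative_eq_intros refl)+
      (auto simp: fun_eq_iff matrix_vector_mult_add_rdistrib scaleR_matrix_vector_assoc[symmetric]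
        outer_mult_vec inner_commute algebra_simps)
qed (intro continuous_intros continuous_on_outer)

definition radial_op ::
  "(real^'n \<Rightarrow> real^'n \<Rightarrow> real^'n^'n \<Rightarrow> real) \<Rightarrow> real^'n \<Rightarrow> real \<Rightarrow> real \<Rightarrow> real \<Rightarrow> real" where
  "radial_op F e r d q = F (r *\<^sub>R e) e (radial_hessian e d q)"

text \<open>The operator of the equation satisfied by \<open>- v\<close>; it turns statements on super-solutions into
  statements on sub-solutions.\<close>

definition dual_op ::
  "(real^'n \<Rightarrow> real^'n \<Rightarrow> real^'n^'n \<Rightarrow> real) \<Rightarrow> real^'n \<Rightarrow> real^'n \<Rightarrow> real^'n^'n \<Rightarrow> real" where
  "dual_op F x p M = - F x (- p) (- M)"

lemma C2_grad_hess_minus: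
  assumes "C2_grad_hess \<Omega> \<phi> g H"
  shows "C2_grad_hess \<Omega> (\<lambda>x. - \<phi> x) (\<lambda>x. - g x) (\<lambda>x. - H x)"
  unfolding C2_grad_hess_def
proof (intro conjI ballI)
  fix x assume "x \<in> \<Omega>"
  then have 1: "(\<phi> has_derivative (\<lambda>h. g x \<bullet> h)) (at x)" "(g has_derivative (\<lambda>h. H x *v h)) (at x)"
    using assms by (auto simp: C2_grad_hess_def)
  show "((\<lambda>x. - \<phi> x) has_derivative (\<lambda>h. - g x \<bullet> h)) (at x)"
    using has_derivative_minus[OF 1(1)] by simp
  have "(\<lambda>h. - H x *v h) = (\<lambda>h. - (H x *v h))"
    by (auto simp: fun_eq_iff matrix_vector_mult_def vec_eq_iff sum_negf)
  then show "((\<lambda>x. - g x) has_derivative (\<lambda>h. - H x *v h)) (at x)"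
    using has_derivative_minus[OF 1(2)] by simp
qed (use assms in \<open>auto simp: C2_grad_hess_def intro!: continuous_intros\<close>)

lemma viscosity_supersolution_dual:
  fixes \<Omega> :: "(real^'n) set"
  assumes "viscosity_subsolution \<Omega> F f v"
  shows "viscosity_supersolution \<Omega> (dual_op F) (\<lambda>r. - f r) (\<lambda>x. - v x)"
  unfolding viscosity_supersolution_def
proof (intro conjI ballI)
  show "continuous_on \<Omega> (\<lambda>x. - v x)"
    using assms by (auto simp: viscosity_subsolution_def intro!: continuous_intros)
  fix x0 assume x0: "x0 \<in> \<Omega>"
  let ?const = "\<lambda>v::real^'n \<Rightarrow> real. \<lambda>f. \<exists>\<delta>>0. ball x0 \<delta> \<subseteq> \<Omega> \<and> v constant_on ball x0 \<delta> \<and> (\<forall>x\<in>ball x0 \<delta>. 0 \<le> (f (norm x) :: real))"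
  show "?const (\<lambda>x. - v x) (\<lambda>r. - f r) \<or>
    (\<forall>\<phi> g H. C2_grad_hess \<Omega> \<phi> g H \<longrightarrow>
       (\<forall>\<^sub>F x in nhds x0. - v x0 - \<phi> x0 \<le> - v x - \<phi> x) \<longrightarrow> g x0 \<noteq> 0 \<longrightarrow>
       dual_op F x0 (g x0) (H x0) \<le> - f (norm x0))"
  proof (cases "?const (\<lambda>x. - v x) (\<lambda>r. - f r)")
    case False
    have "\<not> (\<exists>\<delta>>0. ball x0 \<delta> \<subseteq> \<Omega> \<and> v constant_on ball x0 \<delta> \<and> (\<forall>x\<in>ball x0 \<delta>. 0 \<ge> f (norm x)))"
    proof
      assume "\<exists>\<delta>>0. ball x0 \<delta> \<subseteq> \<Omega> \<and> v constant_on ball x0 \<delta> \<and> (\<forall>x\<in>ball x0 \<delta>. 0 \<ge> f (norm x))"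
      then have "?const (\<lambda>x. - v x) (\<lambda>r. - f r)" unfolding constant_on_def by fastforce
      with False show False by blast
    qed
    then have main: "\<And>\<phi> g H. C2_grad_hess \<Omega> \<phi> g H \<Longrightarrow>
        (\<forall>\<^sub>F x in nhds x0. v x - \<phi> x \<le> v x0 - \<phi> x0) \<Longrightarrow> g x0 \<noteq> 0 \<Longrightarrow>
        F x0 (g x0) (H x0) \<ge> f (norm x0)"
      using assms x0 unfolding viscosity_subsolution_def by blast
    show ?thesis
    proof (intro disjI2 allI impI)
      fix \<phi> g H assume *: "C2_grad_hess \<Omega> \<phi> g H"
        "\<forall>\<^sub>F x in nhds x0. - v x0 - \<phi> x0 \<le> - v x - \<phi> x" "g x0 \<noteq> 0"
      have "\<forall>\<^sub>F x in nhds x0. v x - (- \<phi> x) \<le> v x0 - (- \<phi> x0)"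
        using *(2) by eventually_elim simp
      from main[OF C2_grad_hess_minus[OF *(1)] this] *(3)
      show "dual_op F x0 (g x0) (H x0) \<le> - f (norm x0)" by (simp add: dual_op_def)
    qed
  qed auto
qed

locale elliptic_operator =
  fixes \<Omega> :: "(real^'n) set" and F :: "real^'n \<Rightarrow> real^'n \<Rightarrow> real^'n^'n \<Rightarrow> real" and \<alpha> a A :: real
  assumes constants: "\<alpha> \<ge> 0" "a > 0" "A > 0"
    and F_cont: "continuous_on (\<Omega> \<times> (UNIV - {0}) \<times> sym_matrices) (\<lambda>(x, p, M). F x p M)"
    and F_hom: "\<And>x p M t \<mu>. x \<in> \<Omega> \<Longrightarrow> p \<noteq> 0 \<Longrightarrow> M \<in> sym_matrices \<Longrightarrow> t \<noteq> 0 \<Longrightarrow> \<mu> > 0 \<Longrightarrow>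
        F x (t *\<^sub>R p) (\<mu> *\<^sub>R M) = \<bar>t\<bar> powr \<alpha> * \<mu> * F x p M"
    and F_ell: "\<And>x p M Q. x \<in> \<Omega> \<Longrightarrow> p \<noteq> 0 \<Longrightarrow> M \<in> sym_matrices \<Longrightarrow> Q \<in> sym_matrices \<Longrightarrow> psd Q \<Longrightarrow>
        a * norm p powr \<alpha> * trace Q \<le> F x p (M + Q) - F x p M \<and>
        F x p (M + Q) - F x p M \<le> A * norm p powr \<alpha> * trace Q"
begin

lemma dual: "elliptic_operator \<Omega> (dual_op F) \<alpha> a A"
proof
  show "continuous_on (\<Omega> \<times> (UNIV - {0}) \<times> sym_matrices) (\<lambda>(x, p, M). dual_op F x p M)"
    unfolding dual_op_def case_prod_beta
    by (intro continuous_intros continuous_on_compose2[OF F_cont[unfolded case_prod_beta],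
          where f = "\<lambda>z. (fst z, - fst (snd z), - snd (snd z))", simplified])
       (auto intro: sym_matrices_algebra)
next
  fix x p :: "real^'n" and M :: "real^'n^'n" and t \<mu> :: real
  assume "x \<in> \<Omega>" "p \<noteq> 0" "M \<in> sym_matrices" "t \<noteq> 0" "(\<mu>::real) > 0"
  then show "dual_op F x (t *\<^sub>R p) (\<mu> *\<^sub>R M) = \<bar>t\<bar> powr \<alpha> * \<mu> * dual_op F x p M"
    using F_hom[of x "- p" "- M" t \<mu>] by (simp add: dual_op_def sym_matrices_algebra)
next
  fix x p :: "real^'n" and M Q :: "real^'n^'n"
  assume *: "x \<in> \<Omega>" "p \<noteq> 0" "M \<in> sym_matrices" "Q \<in> sym_matrices" "psd Q"
  have "- (M + Q) \<in> sym_matrices" using * by (intro sym_matrices_algebra)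
  then show "a * norm p powr \<alpha> * trace Q \<le> dual_op F x p (M + Q) - dual_op F x p M \<and>
        dual_op F x p (M + Q) - dual_op F x p M \<le> A * norm p powr \<alpha> * trace Q"
    using F_ell[of x "- p" "- (M + Q)" Q] * by (simp add: dual_op_def)
qed (use constants in auto)

lemma F_zero:
  assumes "x \<in> \<Omega>" "p \<noteq> 0"
  shows "F x p 0 = 0"
  using F_hom[OF assms sym_matrices_algebra(1), of 1 2] by simp

context
  fixes e :: "real^'n" and r :: real
  assumes e: "norm e = 1" and r: "r *\<^sub>R e \<in> \<Omega>"
begin

lemma e_nonzero: "e \<noteq> 0" using e by auto

lemma radial_op_dual: "radial_op (dual_op F) e r d q = - radial_op F e r (- d) (- q)"
proof -
  have "- radial_hessian e d q = radial_hessian e (- d) (- q)" by (simp add: radial_hessian_def)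
  then show ?thesis
    using F_hom[OF r e_nonzero radial_hessian_sym, of "- 1" 1 e "- d" "- q"]
    by (simp add: radial_op_def dual_op_def)
qed

lemma radial_op_mono:
  assumes "d \<le> d'"
  shows "a * (d' - d) \<le> radial_op F e r d' q - radial_op F e r d q"
proof -
  have "radial_hessian e d' q = radial_hessian e d q + (d' - d) *\<^sub>R outer e"
    by (simp add: radial_hessian_def algebra_simps)
  then show ?thesis
    using F_ell[OF r e_nonzero radial_hessian_sym, of "(d' - d) *\<^sub>R outer e" e d q] assms e
    by (simp add: radial_op_def sym_matrices_algebra psd_scaleR psd_outer trace_scaleR trace_outer norm_eq_1)
qed

lemma radial_op_pos:
  assumes "0 \<le> q"
  shows "0 \<le> radial_op F e r 0 q \<and> radial_op F e r 0 q \<le> A * (real CARD('n) - 1) * q"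
proof -
  have "0 \<le> a * (q * (real CARD('n) - 1))" using assms constants by simp
  moreover have "(mat 1 - outer e) \<in> sym_matrices" by (intro sym_matrices_algebra)
  ultimately show ?thesis
    using F_ell[OF r e_nonzero sym_matrices_algebra(1), of "q *\<^sub>R (mat 1 - outer e)"] assms e F_zero[OF r e_nonzero]
    by (simp add: radial_op_def radial_hessian_def sym_matrices_algebra(7) psd_scaleR psd_outer_compl
        trace_scaleR trace_outer_compl mult_ac)
qed

end

lemma radial_op_neg:
  assumes "norm e = 1" "r *\<^sub>R e \<in> \<Omega>" "q \<le> 0"
  shows "A * (real CARD('n) - 1) * q \<le> radial_op F e r 0 q \<and> radial_op F e r 0 q \<le> 0"
  using elliptic_operator.radial_op_pos[OF dual assms(1,2), of "- q"] assms(3)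
  by (simp add: radial_op_dual[OF assms(1,2)])

lemma radial_op_cont:
  assumes "norm e = 1" "\<And>r. r \<in> J \<Longrightarrow> r *\<^sub>R e \<in> \<Omega>"
  shows "continuous_on (J \<times> UNIV \<times> UNIV) (\<lambda>(r, d, q). radial_op F e r d q)"
  unfolding radial_op_def case_prod_beta
  by (rule continuous_on_compose2[OF F_cont[unfolded case_prod_beta],
        where f = "\<lambda>z. (fst z *\<^sub>R e, e, radial_hessian e (fst (snd z)) (snd (snd z)))", simplified])
     (use assms in \<open>auto intro!: continuous_intros continuous_on_radial_hessian\<close>)

end

section \<open>Radial viscosity solutions\<close>

context elliptic_operator
begin

text \<open>A parabola in the variable \<open>\<bar>x\<bar>\<close> is in general not \<open>C\<^sup>2\<close> at the origin. It is replaced by a quadratic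
  polynomial in \<open>x \<bullet> x\<close> with the same slope and a slightly smaller radial second derivative \<open>d'\<close>; then
  \<open>d'\<close> tends to \<open>d\<close>. The alternative that \<open>v\<close> is constant near the point cannot occur, as the slope \<open>b\<close> is not
  \<open>0\<close>.\<close>

lemma supersolution_subjet:
  assumes \<Omega>: "open \<Omega>" and rad: "\<And>x. x \<in> \<Omega> \<Longrightarrow> v x = u (norm x)"
    and v: "viscosity_supersolution \<Omega> F f v"
    and e: "norm e = 1" and r: "r > 0" "r *\<^sub>R e \<in> \<Omega>"
    and b: "b \<noteq> 0" and jet: "subjet u r b d"
  shows "\<bar>b\<bar> powr \<alpha> * radial_op F e r d (b / r) \<le> f r"
proof -
  define x0 where "x0 = r *\<^sub>R e"
  have x0: "x0 \<in> \<Omega>" "norm x0 = r" "x0 \<bullet> x0 = r\<^sup>2"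
    using r e by (auto simp: x0_def power2_eq_square norm_eq_1)
  have e0: "e \<noteq> 0" using e by auto
  have norm_lim: "filterlim norm (nhds r) (nhds x0)"
    using tendsto_norm[OF filterlim_ident[of "nhds x0"]] x0 by simp
  have in\<Omega>: "\<forall>\<^sub>F x in nhds x0. x \<in> \<Omega>" using \<Omega> x0 by (intro eventually_nhds_in_open)
  have not_const: "\<not> (\<exists>\<delta>>0. ball x0 \<delta> \<subseteq> \<Omega> \<and> v constant_on ball x0 \<delta> \<and> (\<forall>x\<in>ball x0 \<delta>. 0 \<le> f (norm x)))"
  proof
    assume "\<exists>\<delta>>0. ball x0 \<delta> \<subseteq> \<Omega> \<and> v constant_on ball x0 \<delta> \<and> (\<forall>x\<in>ball x0 \<delta>. 0 \<le> f (norm x))"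
    then obtain \<delta> k where \<delta>: "\<delta> > 0" "ball x0 \<delta> \<subseteq> \<Omega>" "\<And>x. x \<in> ball x0 \<delta> \<Longrightarrow> v x = k"
      unfolding constant_on_def by blast
    have u: "u s = k" if "\<bar>s - r\<bar> < min \<delta> r" for s
    proof -
      have "dist x0 (s *\<^sub>R e) = \<bar>s - r\<bar>"
        using e by (simp add: x0_def dist_norm scaleR_diff_left[symmetric] abs_minus_commute)
      then have s: "s *\<^sub>R e \<in> ball x0 \<delta>" using that by simp
      have "norm (s *\<^sub>R e) = s" using that e by auto
      then show ?thesis using \<delta>(3)[OF s] rad[of "s *\<^sub>R e"] \<delta>(2) s by auto
    qed
    obtain \<eta> where \<eta>: "\<eta> > 0" "\<And>s. dist s r < \<eta> \<Longrightarrow> u r + b * (s - r) + d / 2 * (s - r)\<^sup>2 \<le> u s"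
      using jet unfolding subjet_def eventually_nhds_metric by blast
    have "((\<lambda>s. b * (s - r) + d / 2 * (s - r)\<^sup>2) has_real_derivative b) (at r)"
      by (auto intro!: derivative_eq_intros)
    then have "b = 0"
    proof (rule DERIV_local_max)
      show "0 < min \<eta> (min \<delta> r)" using \<eta>(1) \<delta>(1) r(1) by simp
      show "\<forall>s. \<bar>r - s\<bar> < min \<eta> (min \<delta> r) \<longrightarrow>
          b * (s - r) + d / 2 * (s - r)\<^sup>2 \<le> b * (r - r) + d / 2 * (r - r)\<^sup>2"
      proof (intro allI impI)
        fix s assume "\<bar>r - s\<bar> < min \<eta> (min \<delta> r)"
        then show "b * (s - r) + d / 2 * (s - r)\<^sup>2 \<le> b * (r - r) + d / 2 * (r - r)\<^sup>2"
          using \<eta>(2)[of s] u[of s] u[of r] \<delta>(1) r(1) by (simp add: dist_real_def abs_minus_commute)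
      qed
    qed
    with b show False by simp
  qed
  have le: "\<bar>b\<bar> powr \<alpha> * radial_op F e r d' (b / r) \<le> f r" if d': "d' < d" for d'
  proof -
    \<comment> \<open>chosen so that \<open>B * (s\<^sup>2 - r\<^sup>2) + D / 2 * (s\<^sup>2 - r\<^sup>2)\<^sup>2\<close> has the derivatives \<open>b\<close> and \<open>d'\<close> at \<open>s = r\<close>\<close>
    define B where "B = b / (2 * r)"
    define D where "D = (d' - b / r) / (4 * r\<^sup>2)"
    have BD: "2 * B * r = b" "2 * B = b / r" "4 * D * r\<^sup>2 = d' - b / r"
      using r by (auto simp: B_def D_def)
    define \<phi> where "\<phi> = (\<lambda>x::real^'n. B * (x \<bullet> x - r\<^sup>2) + D / 2 * (x \<bullet> x - r\<^sup>2)\<^sup>2)"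
    define \<psi> where "\<psi> = (\<lambda>s. B * (s\<^sup>2 - r\<^sup>2) + D / 2 * (s\<^sup>2 - r\<^sup>2)\<^sup>2)"
    define h where "h = (\<lambda>s. b * (s - r) + d / 2 * (s - r)\<^sup>2 - \<psi> s)"
    have "\<forall>\<^sub>F s in nhds r. h r \<le> h s"
    proof (rule second_derivative_test[where d = "d - d'" and
          h' = "\<lambda>s. b + d * (s - r) - (2 * B * s + 2 * D * s * (s\<^sup>2 - r\<^sup>2))"])
      show "\<forall>\<^sub>F s in nhds r. (h has_real_derivative b + d * (s - r) - (2 * B * s + 2 * D * s * (s\<^sup>2 - r\<^sup>2))) (at s)"
        unfolding h_def \<psi>_def
        by (intro always_eventually allI) (auto intro!: derivative_eq_intros simp: algebra_simps power2_eq_square)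
      have "((\<lambda>s. b + d * (s - r) - (2 * B * s + 2 * D * s * (s\<^sup>2 - r\<^sup>2))) has_real_derivative
          d - (2 * B + 4 * D * r\<^sup>2)) (at r)"
        by (auto intro!: derivative_eq_intros simp: algebra_simps power2_eq_square)
      then show "((\<lambda>s. b + d * (s - r) - (2 * B * s + 2 * D * s * (s\<^sup>2 - r\<^sup>2))) has_real_derivative d - d') (at r)"
        using BD by simp
    qed (use BD d' in auto)
    with jet have "\<forall>\<^sub>F s in nhds r. u r - \<psi> r \<le> u s - \<psi> s"
      unfolding subjet_def by eventually_elim (simp add: h_def \<psi>_def)
    then have "\<forall>\<^sub>F x in nhds x0. u r - \<psi> r \<le> u (norm x) - \<psi> (norm x)"
      using norm_lim by (rule eventually_compose_filterlim)
    with in\<Omega> have touch: "\<forall>\<^sub>F x in nhds x0. v x0 - \<phi> x0 \<le> v x - \<phi> x"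
      by eventually_elim (use rad x0 in \<open>simp add: \<phi>_def \<psi>_def power2_norm_eq_inner\<close>)
    have test: "F x0 (g x0) (H x0) \<le> f (norm x0)"
      if "C2_grad_hess \<Omega> \<phi> g H" "g x0 \<noteq> 0" for g H
      using v x0(1) not_const touch that unfolding viscosity_supersolution_def by blast
    have grad: "(2 * B + 2 * D * (x0 \<bullet> x0 - r\<^sup>2)) *\<^sub>R x0 = b *\<^sub>R e"
      using BD by (simp add: x0) (simp add: x0_def)
    have hess: "(2 * B + 2 * D * (x0 \<bullet> x0 - r\<^sup>2)) *\<^sub>R mat 1 + (4 * D) *\<^sub>R outer x0 = radial_hessian e d' (b / r)"
    proof -
      have "(4 * D) *\<^sub>R outer x0 = (d' - b / r) *\<^sub>R outer e"
        by (simp add: x0_def outer_scaleR BD(3)[symmetric])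
      then show ?thesis using BD by (simp add: x0 radial_hessian_def algebra_simps)
    qed
    have "F x0 (b *\<^sub>R e) (radial_hessian e d' (b / r)) \<le> f r"
      using test[OF C2_radial_quartic[of \<Omega> B "r\<^sup>2" D, folded \<phi>_def]] b e0 x0(2) unfolding grad hess by simp
    then show ?thesis
      using F_hom[OF x0(1) e0 radial_hessian_sym, of b 1 e d' "b / r"] b
      by (simp add: radial_op_def x0_def)
  qed
  have "continuous_on ({r} \<times> UNIV \<times> UNIV) (\<lambda>(r, d, q). radial_op F e r d q)"
    using e r by (intro radial_op_cont) auto
  then have "continuous_on UNIV (\<lambda>d'. case (r, d', b / r) of (r, d, q) \<Rightarrow> radial_op F e r d q)"
    by (rule continuous_on_compose2) (auto intro!: continuous_intros)
  then have "continuous_on UNIV (\<lambda>d'. \<bar>b\<bar> powr \<alpha> * radial_op F e r d' (b / r))"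
    by (auto intro: continuous_intros)
  then have "((\<lambda>d'. \<bar>b\<bar> powr \<alpha> * radial_op F e r d' (b / r)) \<longlongrightarrow>
      \<bar>b\<bar> powr \<alpha> * radial_op F e r d (b / r)) (at_left d)"
    by (simp add: continuous_on_eq_continuous_at isCont_def filterlim_at_split)
  then show ?thesis
    by (rule tendsto_upperbound) (auto simp: eventually_at_filter le)
qed

text \<open>Below a cone with vertex at \<open>0\<close> there is room for the test functions \<open>p \<bullet> x + K / 2 * (x \<bullet> x)\<close> with a fixed
  \<open>p \<noteq> 0\<close> and every \<open>K > 0\<close>. The operator is linear in \<open>K\<close> on their Hessians, with a positive coefficient, which
  contradicts the upper bound \<open>f 0\<close>.\<close>

lemma supersolution_no_cone:
  assumes v: "viscosity_supersolution \<Omega> F f v" and 0: "0 \<in> \<Omega>" and k: "k > 0"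
    and cone: "\<forall>\<^sub>F x in nhds 0. v 0 + k * norm x \<le> v x"
  shows False
proof -
  obtain e :: "real^'n" where e: "norm e = 1" using vector_choose_size[of 1] by auto
  define p where "p = (k / 2) *\<^sub>R e"
  have p: "norm p = k / 2" "p \<noteq> 0" using e k by (auto simp: p_def)
  obtain \<rho> where \<rho>: "\<rho> > 0" "\<And>x. dist x 0 < \<rho> \<Longrightarrow> v 0 + k * norm x \<le> v x"
    using cone unfolding eventually_nhds_metric by blast
  have not_const: "\<not> (\<exists>\<delta>>0. ball 0 \<delta> \<subseteq> \<Omega> \<and> v constant_on ball 0 \<delta> \<and> (\<forall>x\<in>ball 0 \<delta>. 0 \<le> f (norm x)))"
  proof
    assume "\<exists>\<delta>>0. ball 0 \<delta> \<subseteq> \<Omega> \<and> v constant_on ball 0 \<delta> \<and> (\<forall>x\<in>ball 0 \<delta>. 0 \<le> f (norm x))"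
    then obtain \<delta> c where \<delta>: "\<delta> > 0" "\<And>x. x \<in> ball 0 \<delta> \<Longrightarrow> v x = c"
      unfolding constant_on_def by blast
    define x where "x = (min \<delta> \<rho> / 2) *\<^sub>R e"
    have x: "norm x = min \<delta> \<rho> / 2" using e \<rho>(1) \<delta>(1) by (simp add: x_def)
    then have "v x = v 0" using \<delta>(2)[of x] \<delta>(2)[of 0] \<delta>(1) \<rho>(1) by simp
    moreover have "v 0 + k * norm x \<le> v x" using \<rho> \<delta>(1) x by (intro \<rho>(2)) auto
    moreover have "k * norm x > 0" using x k \<rho>(1) \<delta>(1) by (intro mult_pos_pos) auto
    ultimately show False by simp
  qed
  have test: "F 0 p (K *\<^sub>R mat 1) \<le> f 0" if K: "K > 0" for K
  proof -
    define \<phi> where "\<phi> = (\<lambda>x::real^'n. p \<bullet> x + K / 2 * (x \<bullet> x))"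
    have "\<forall>\<^sub>F x in nhds 0. v 0 - \<phi> 0 \<le> v x - \<phi> x"
      unfolding eventually_nhds_metric
    proof (intro exI conjI allI impI)
      show "min \<rho> (k / K) > 0" using \<rho>(1) k K by simp
      fix x :: "real^'n" assume x: "dist x 0 < min \<rho> (k / K)"
      have "p \<bullet> x \<le> k / 2 * norm x" using norm_cauchy_schwarz[of p x] p by simp
      moreover have "K * norm x \<le> k" using x K by (simp add: field_simps)
      then have "K / 2 * (x \<bullet> x) \<le> k / 2 * norm x"
        using mult_right_mono[of "K * norm x" k "norm x / 2"]
        by (simp add: power2_norm_eq_inner[symmetric] power2_eq_square mult_ac)
      moreover have "v 0 + k * norm x \<le> v x" using \<rho>(2)[of x] x by simp
      ultimately show "v 0 - \<phi> 0 \<le> v x - \<phi> x" by (simp add: \<phi>_def)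
    qed
    moreover have "C2_grad_hess \<Omega> \<phi> (\<lambda>x. p + K *\<^sub>R x) (\<lambda>x. K *\<^sub>R mat 1)"
      unfolding \<phi>_def by (rule C2_quadratic)
    moreover have "F 0 (g 0) (H 0) \<le> f (norm (0 :: real^'n))"
      if "C2_grad_hess \<Omega> \<phi> g H" "\<forall>\<^sub>F x in nhds 0. v 0 - \<phi> 0 \<le> v x - \<phi> x" "g 0 \<noteq> 0" for g H
      using v 0 not_const that unfolding viscosity_supersolution_def by blast
    ultimately have "F 0 (p + K *\<^sub>R 0) (K *\<^sub>R mat 1) \<le> f (norm (0 :: real^'n))"
      using p(2) by force
    then show ?thesis by simp
  qed
  define m where "m = F 0 p (mat 1)"
  have "psd (mat 1 :: real^'n^'n)" by (simp add: psd_def)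
  then have "a * norm p powr \<alpha> * trace (mat 1 :: real^'n^'n) \<le> m"
    using F_ell[OF 0 p(2) sym_matrices_algebra(1,2)] F_zero[OF 0 p(2)] by (simp add: m_def)
  moreover have "0 < a * norm p powr \<alpha> * trace (mat 1 :: real^'n^'n)"
    using constants p k by (simp add: trace_I)
  ultimately have m: "m > 0" by linarith
  define K where "K = (\<bar>f 0\<bar> + 1) / m"
  have K: "K > 0" using m by (simp add: K_def)
  have "F 0 p (K *\<^sub>R mat 1) = K * m"
    using F_hom[OF 0 p(2) sym_matrices_algebra(2), of 1 K] K by (simp add: m_def)
  then have "K * m \<le> f 0" using test[OF K] by simp
  then show False using m by (simp add: K_def)
qed

lemma radial_equation_of_solution:
  assumes \<Omega>: "open \<Omega>" and lo: "0 \<le> lo" and e: "norm e = 1"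
    and J: "\<And>r. r \<in> {lo<..<hi} \<Longrightarrow> r *\<^sub>R e \<in> \<Omega>"
    and f: "continuous_on {lo<..<hi} f"
    and rad: "\<And>x. x \<in> \<Omega> \<Longrightarrow> v x = u (norm x)"
    and v: "viscosity_solution \<Omega> F f v"
  shows "radial_equation lo hi \<alpha> a (A * (real CARD('n) - 1)) (radial_op F e) f u"
proof
  show "0 \<le> A * (real CARD('n) - 1)" using constants by simp
  fix r d d' q :: real assume r: "r \<in> {lo<..<hi}"
  show "a * (d' - d) \<le> radial_op F e r d' q - radial_op F e r d q" if "d \<le> d'"
    by (rule radial_op_mono[OF e J[OF r] that])
  show "0 \<le> radial_op F e r 0 q \<and> radial_op F e r 0 q \<le> A * (real CARD('n) - 1) * q" if "0 \<le> q"
    by (rule radial_op_pos[OF e J[OF r] that])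
  show "A * (real CARD('n) - 1) * q \<le> radial_op F e r 0 q \<and> radial_op F e r 0 q \<le> 0" if "q \<le> 0"
    by (rule radial_op_neg[OF e J[OF r] that])
next
  show "continuous_on ({lo<..<hi} \<times> UNIV \<times> UNIV) (\<lambda>(r, d, q). radial_op F e r d q)"
    by (rule radial_op_cont[OF e J])
  have "continuous_on \<Omega> v" using v by (simp add: viscosity_solution_def viscosity_subsolution_def)
  then have "continuous_on {lo<..<hi} (\<lambda>r. v (r *\<^sub>R e))"
    by (rule continuous_on_compose2) (use J in \<open>auto intro!: continuous_intros\<close>)
  moreover have "v (r *\<^sub>R e) = u r" if "r \<in> {lo<..<hi}" for r
    using rad[OF J[OF that]] e that lo by simp
  ultimately show "continuous_on {lo<..<hi} u" by (rule continuous_on_eq)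
next
  fix r b d :: real assume r: "r \<in> {lo<..<hi}" and b: "b \<noteq> 0"
  have r0: "r > 0" using r lo by simp
  show "\<bar>b\<bar> powr \<alpha> * radial_op F e r d (b / r) \<le> f r" if "subjet u r b d"
    using v by (intro supersolution_subjet[where v = v and u = u, OF \<Omega> rad _ e r0 J[OF r] b that])
      (auto simp: viscosity_solution_def)
  show "f r \<le> \<bar>b\<bar> powr \<alpha> * radial_op F e r (- d) (- b / r)" if "subjet (\<lambda>s. - u s) r b d"
  proof -
    have "viscosity_supersolution \<Omega> (dual_op F) (\<lambda>r. - f r) (\<lambda>x. - v x)"
      using v by (intro viscosity_supersolution_dual) (simp add: viscosity_solution_def)
    then have "\<bar>b\<bar> powr \<alpha> * radial_op (dual_op F) e r d (b / r) \<le> - f r"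
      using rad by (intro elliptic_operator.supersolution_subjet[where v = "\<lambda>x. - v x" and f = "\<lambda>r. - f r",
            OF dual \<Omega> _ _ e r0 J[OF r] b that]) auto
    then show ?thesis by (simp add: radial_op_dual[OF e J[OF r]])
  qed
qed (use lo constants f in auto)

end

section \<open>Regularity on the interval of radii\<close>

lemma locally_holder_continuous:
  assumes "\<beta> > 0" "locally_holder_on \<beta> J w"
  shows "continuous_on J w"
  unfolding continuous_on_def
proof
  fix r assume r: "r \<in> J"
  obtain \<epsilon> C where \<epsilon>: "\<epsilon> > 0" and C: "\<And>s t. s \<in> J \<inter> ball r \<epsilon> \<Longrightarrow> t \<in> J \<inter> ball r \<epsilon> \<Longrightarrow>
      \<bar>w s - w t\<bar> \<le> C * \<bar>s - t\<bar> powr \<beta>"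
    using assms(2) r unfolding locally_holder_on_def by blast
  have "((\<lambda>s. C * \<bar>s - r\<bar> powr \<beta>) \<longlongrightarrow> C * 0) (at r within J)"
    by (intro tendsto_mult tendsto_const tendsto_zero_powrI[where b = \<beta>] tendsto_rabs_zero LIM_zero tendsto_ident_at)
       (use assms(1) in auto)
  then have lim: "((\<lambda>s. C * \<bar>s - r\<bar> powr \<beta>) \<longlongrightarrow> 0) (at r within J)" by simp
  have "\<forall>\<^sub>F s in at r within J. s \<in> J \<inter> ball r \<epsilon>"
    unfolding eventually_at using \<epsilon> by (auto simp: dist_commute)
  then have "\<forall>\<^sub>F s in at r within J. norm (w s - w r) \<le> C * \<bar>s - r\<bar> powr \<beta>"
    by eventually_elim (use C[of _ r] r \<epsilon> in auto)
  then have "((\<lambda>s. w s - w r) \<longlongrightarrow> 0) (at r within J)"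
    using lim by (rule Lim_null_comparison)
  then show "(w \<longlongrightarrow> w r) (at r within J)" by (simp add: LIM_zero_iff)
qed

lemma has_derivative_at_left_end:
  fixes u w :: "real \<Rightarrow> real"
  assumes R: "0 < R" and u: "continuous_on {0..<R} u"
    and u': "\<And>r. 0 < r \<Longrightarrow> r < R \<Longrightarrow> (u has_real_derivative w r) (at r)"
    and w: "continuous_on {0..<R} w"
  shows "(u has_real_derivative w 0) (at 0 within {0..<R})"
  unfolding has_field_derivative_iff tendsto_iff
proof (intro allI impI)
  fix e :: real assume "e > 0"
  then obtain \<delta> where \<delta>: "\<delta> > 0" "\<And>r. r \<in> {0..<R} \<Longrightarrow> dist r 0 < \<delta> \<Longrightarrow> dist (w r) (w 0) < e"
    using w R unfolding continuous_on_iff by (metis atLeastLessThan_iff order_refl)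
  have "dist ((u r - u 0) / (r - 0)) (w 0) < e" if r: "0 < r" "r < R" "r < \<delta>" for r
  proof -
    have "continuous_on {0..r} u" using r by (intro continuous_on_subset[OF u]) auto
    moreover have "u differentiable (at x)" if "0 < x" "x < r" for x
      using u'[of x] that r by (auto simp: real_differentiable_def)
    ultimately obtain l z where z: "0 < z" "z < r" "(u has_real_derivative l) (at z)" "u r - u 0 = (r - 0) * l"
      using MVT[OF r(1), of u] by blast
    then have "l = w z" using DERIV_unique u'[of z] r by auto
    then show ?thesis using z r \<delta>(2)[of z] by (simp add: dist_real_def)
  qed
  then show "\<forall>\<^sub>F r in at 0 within {0..<R}. dist ((u r - u 0) / (r - 0)) (w 0) < e"
    unfolding eventually_at using \<delta>(1) R by (intro exI[of _ \<delta>]) (auto simp: dist_real_def)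
qed

context radial_equation
begin

lemma C2_at_in_interior:
  assumes r: "r \<in> {lo<..<hi}" "deriv u r \<noteq> 0" and I: "{lo<..<hi} \<subseteq> I"
  shows "C2_at_in I u r"
proof -
  have "open ({lo<..<hi} \<inter> deriv u -` (- {0}))"
    by (intro continuous_open_preimage continuous_on_deriv_u) auto
  then obtain \<epsilon> where \<epsilon>: "\<epsilon> > 0" "ball r \<epsilon> \<subseteq> {lo<..<hi} \<inter> deriv u -` (- {0})"
    using r openE by blast
  have B: "I \<inter> ball r \<epsilon> = ball r \<epsilon>" using \<epsilon> I by auto
  have J: "s \<in> {lo<..<hi}" "deriv u s \<noteq> 0" if "s \<in> ball r \<epsilon>" for s using \<epsilon>(2) that by auto
  have "continuous_on (ball r \<epsilon>) (deriv u)" using \<epsilon>(2) by (intro continuous_on_deriv_u) auto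
  then have "C1_deriv_on (ball r \<epsilon>) u (deriv u)"
    unfolding C1_deriv_on_def using J u_C1(1) by (auto intro: has_field_derivative_at_within)
  moreover have "C1_deriv_on (ball r \<epsilon>) (deriv u) (\<lambda>s. curv s (deriv u s))"
    unfolding C1_deriv_on_def
  proof (intro conjI ballI continuous_at_imp_continuous_on)
    fix s assume s: "s \<in> ball r \<epsilon>"
    show "(deriv u has_real_derivative curv s (deriv u s)) (at s within ball r \<epsilon>)"
      by (rule has_field_derivative_at_within[OF deriv_u_ode[OF J[OF s]]])
    show "isCont (\<lambda>s. curv s (deriv u s)) s"
      by (rule isCont_curv[OF J(1)[OF s] u_C1(2)[OF J(1)[OF s]] J(2)[OF s]])
  qed
  ultimately show ?thesis unfolding C2_at_in_def using \<epsilon>(1) B by metis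
qed

lemma regularity_open_interval:
  "C1_deriv_on {lo<..<hi} u (deriv u)"
  "locally_holder_on (1 / (1 + \<alpha>)) {lo<..<hi} (deriv u)"
proof -
  show "C1_deriv_on {lo<..<hi} u (deriv u)"
    unfolding C1_deriv_on_def using u_C1(1) continuous_on_deriv_u[of "{lo<..<hi}"]
    by (auto intro: has_field_derivative_at_within)
  show "locally_holder_on (1 / (1 + \<alpha>)) {lo<..<hi} (deriv u)"
    unfolding locally_holder_on_def using deriv_u_locally_holder by fast
qed

text \<open>Since \<open>\<bar>u'\<bar> powr (1 + \<alpha>)\<close> is at most \<open>L * r\<close> near the origin, the Hoelder constants of \<open>u'\<close> stay bounded as \<open>r\<close>
  tends to \<open>0\<close>, and \<open>u'\<close> extends by \<open>0\<close>. Differentiability at \<open>0\<close> then follows from the continuity of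
  the extended derivative.\<close>

lemma regularity_with_origin:
  assumes lo0: "lo = 0" and hi: "0 < hi"
    and u0: "continuous_on {0..<hi} u" and f0: "continuous_on {0..<hi} f"
    and no_cone: "\<And>k. k > 0 \<Longrightarrow> \<not> (\<forall>\<^sub>F r in at_right 0. k * r \<le> u r - u 0)"
      "\<And>k. k > 0 \<Longrightarrow> \<not> (\<forall>\<^sub>F r in at_right 0. k * r \<le> u 0 - u r)"
  defines "u' \<equiv> \<lambda>r. if r = 0 then 0 else deriv u r"
  shows "C1_deriv_on {0..<hi} u u'" "locally_holder_on (1 / (1 + \<alpha>)) {0..<hi} u'"
proof -
  define \<beta> where "\<beta> = 1 / (1 + \<alpha>)"
  have \<beta>: "\<beta> > 0" using \<alpha> by (simp add: \<beta>_def)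
  define \<rho> where "\<rho> = hi / 2"
  have \<rho>: "0 < \<rho>" "\<rho> < hi" using hi by (auto simp: \<rho>_def)
  have "{0..\<rho>} \<subseteq> {0..<hi}" using \<rho> by auto
  then obtain B where B: "B \<ge> 0" "\<And>r. r \<in> {0..\<rho>} \<Longrightarrow> \<bar>f r\<bar> \<le> B"
    using continuous_on_Icc_bound[OF continuous_on_subset[OF f0]] by blast
  define L where "L = (1 + \<alpha>) * B / a"
  have L: "L \<ge> 0" using \<alpha> a B by (simp add: L_def)
  have growth: "\<bar>deriv u r\<bar> powr (1 + \<alpha>) \<le> L * r" if "0 < r" "r \<le> \<rho>" for r
    unfolding L_def using B that by (intro deriv_u_near_origin[OF lo0 hi u0 no_cone \<rho>(2)]) auto
  define C where "C = 2 * ((1 + \<alpha>) * ((c * L + B) / a)) powr \<beta> + L powr \<beta>"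
  have near: "\<bar>u' s - u' t\<bar> \<le> C * \<bar>s - t\<bar> powr \<beta>" if st: "0 \<le> s" "s \<le> t" "t \<le> \<rho>" for s t
  proof -
    consider "s = t" | "s = 0" "0 < t" | "0 < s" using st by linarith
    then show ?thesis
    proof cases
      case 1
      then show ?thesis by simp
    next
      case 2
      have "\<bar>u' s - u' t\<bar> = (\<bar>deriv u t\<bar> powr (1 + \<alpha>)) powr \<beta>"
        using 2 \<alpha> by (simp add: u'_def powr_powr \<beta>_def)
      also have "\<dots> \<le> (L * t) powr \<beta>" using growth[of t] 2 st \<beta> by (intro powr_mono2) auto
      also have "\<dots> = L powr \<beta> * \<bar>s - t\<bar> powr \<beta>" using 2 L by (simp add: powr_mult)
      also have "\<dots> \<le> C * \<bar>s - t\<bar> powr \<beta>" unfolding C_def by (intro mult_right_mono) auto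
      finally show ?thesis .
    next
      case 3
      have "\<bar>u' s - u' t\<bar> \<le> 2 * ((1 + \<alpha>) * ((c * L + B) / a)) powr \<beta> * \<bar>s - t\<bar> powr \<beta>"
      proof -
        have "{s..t} \<subseteq> {lo<..<hi}" using 3 st lo0 \<rho> by auto
        moreover have "\<bar>f r\<bar> \<le> B" "\<bar>deriv u r\<bar> powr (1 + \<alpha>) \<le> L * r" if "r \<in> {s..t}" for r
          using growth[of r] B(2)[of r] that 3 st by auto
        ultimately have "\<bar>deriv u s - deriv u t\<bar> \<le> 2 * ((1 + \<alpha>) * ((c * L + B) / a)) powr \<beta> * \<bar>s - t\<bar> powr \<beta>"
          unfolding \<beta>_def by (intro deriv_u_holder[OF st(2) _ _ L])
        then show ?thesis using 3 st by (simp add: u'_def)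
      qed
      also have "\<dots> \<le> C * \<bar>s - t\<bar> powr \<beta>" unfolding C_def by (intro mult_right_mono) auto
      finally show ?thesis .
    qed
  qed
  show holder: "locally_holder_on (1 / (1 + \<alpha>)) {0..<hi} u'"
    unfolding locally_holder_on_def \<beta>_def[symmetric]
  proof
    fix r assume r: "r \<in> {0..<hi}"
    show "\<exists>\<epsilon>>0. \<exists>C. \<forall>s\<in>{0..<hi} \<inter> ball r \<epsilon>. \<forall>t\<in>{0..<hi} \<inter> ball r \<epsilon>. \<bar>u' s - u' t\<bar> \<le> C * \<bar>s - t\<bar> powr \<beta>"
    proof (cases "r = 0")
      case True
      have "\<bar>u' s - u' t\<bar> \<le> C * \<bar>s - t\<bar> powr \<beta>"
        if "s \<in> {0..<hi} \<inter> ball r \<rho>" "t \<in> {0..<hi} \<inter> ball r \<rho>" for s t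
        using near[of s t] near[of t s] that True by (cases "s \<le> t") (auto simp: abs_minus_commute)
      then show ?thesis using \<rho>(1) by blast
    next
      case False
      then have "r \<in> {lo<..<hi}" using r lo0 by auto
      then obtain \<epsilon> D where \<epsilon>: "\<epsilon> > 0" "ball r \<epsilon> \<subseteq> {lo<..<hi}"
        and D: "\<And>s t. s \<in> ball r \<epsilon> \<Longrightarrow> t \<in> ball r \<epsilon> \<Longrightarrow> \<bar>deriv u s - deriv u t\<bar> \<le> D * \<bar>s - t\<bar> powr \<beta>"
        using deriv_u_locally_holder unfolding \<beta>_def by meson
      have "u' s = deriv u s" if "s \<in> ball r \<epsilon>" for s
      proof -
        have "s \<in> {lo<..<hi}" using \<epsilon>(2) that by blast
        then show ?thesis using lo0 by (simp add: u'_def)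
      qed
      then have "\<forall>s\<in>{0..<hi} \<inter> ball r \<epsilon>. \<forall>t\<in>{0..<hi} \<inter> ball r \<epsilon>. \<bar>u' s - u' t\<bar> \<le> D * \<bar>s - t\<bar> powr \<beta>"
        using D by simp
      then show ?thesis using \<epsilon>(1) by blast
    qed
  qed
  have cont: "continuous_on {0..<hi} u'"
    using locally_holder_continuous[OF _ holder] \<beta> by (simp add: \<beta>_def)
  have der: "(u has_real_derivative u' r) (at r)" if "0 < r" "r < hi" for r
    using u_C1(1)[of r] that lo0 by (simp add: u'_def)
  have "(u has_real_derivative u' r) (at r within {0..<hi})" if "r \<in> {0..<hi}" for r
    using has_derivative_at_left_end[OF hi u0 der cont] der[of r] that
    by (cases "r = 0") (auto intro: has_field_derivative_at_within)
  then show "C1_deriv_on {0..<hi} u u'" using cont by (simp add: C1_deriv_on_def)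
qed

end

lemma (in elliptic_operator) no_radial_cone:
  assumes v: "viscosity_supersolution \<Omega> F f v" and 0: "0 \<in> \<Omega>" "open \<Omega>"
    and rad: "\<And>x. x \<in> \<Omega> \<Longrightarrow> v x = u (norm x)" and k: "k > 0"
  shows "\<not> (\<forall>\<^sub>F r in at_right 0. k * r \<le> u r - u 0)"
proof
  assume "\<forall>\<^sub>F r in at_right 0. k * r \<le> u r - u 0"
  then obtain \<delta> where \<delta>: "\<delta> > 0" "\<And>r. 0 < r \<Longrightarrow> r < \<delta> \<Longrightarrow> k * r \<le> u r - u 0"
    unfolding eventually_at_right_field by blast
  have ev: "\<forall>\<^sub>F x in nhds (0::real^'n). x \<in> \<Omega>" using 0 by (intro eventually_nhds_in_open)
  have "\<forall>\<^sub>F x in nhds (0::real^'n). x \<in> ball 0 \<delta>" using \<delta>(1) by (intro eventually_nhds_in_open) auto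
  with ev have "\<forall>\<^sub>F x in nhds 0. v 0 + k * norm x \<le> v x"
  proof eventually_elim
    case (elim x)
    then show ?case using \<delta>(2)[of "norm x"] rad[of x] rad[of 0] 0 by (cases "x = 0") auto
  qed
  then show False by (rule supersolution_no_cone[OF v 0(1) k])
qed

theorem theorem4p1:
  fixes \<Omega> :: "(real^'n) set" and I :: "real set"
    and F :: "real^'n \<Rightarrow> real^'n \<Rightarrow> real^'n^'n \<Rightarrow> real"
    and f u :: "real \<Rightarrow> real" and v :: "real^'n \<Rightarrow> real"
    and \<alpha> a A \<nu> \<kappa> :: real
  assumes dom: "radial_domain \<Omega> I"
    and F_cont: "continuous_on (\<Omega> \<times> (UNIV - {0}) \<times> sym_matrices) (\<lambda>(x, p, M). F x p M)"
    and constants: "\<alpha> \<ge> 0" "a > 0" "A > 0"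
    and F_hom: "\<And>x p M t \<mu>. x \<in> \<Omega> \<Longrightarrow> p \<noteq> 0 \<Longrightarrow> M \<in> sym_matrices \<Longrightarrow> t \<noteq> 0 \<Longrightarrow> \<mu> > 0 \<Longrightarrow>
        F x (t *\<^sub>R p) (\<mu> *\<^sub>R M) = \<bar>t\<bar> powr \<alpha> * \<mu> * F x p M"
    and F_ell: "\<And>x p M Q. x \<in> \<Omega> \<Longrightarrow> p \<noteq> 0 \<Longrightarrow> M \<in> sym_matrices \<Longrightarrow> Q \<in> sym_matrices \<Longrightarrow> psd Q \<Longrightarrow>
        a * norm p powr \<alpha> * trace Q \<le> F x p (M + Q) - F x p M \<and>
        F x p (M + Q) - F x p M \<le> A * norm p powr \<alpha> * trace Q"
    and F_inv: "\<And>U x p M. orthogonal_matrix U \<Longrightarrow> x \<in> \<Omega> \<Longrightarrow> p \<noteq> 0 \<Longrightarrow> M \<in> sym_matrices \<Longrightarrow>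
        F (transpose U *v x) (transpose U *v p) (transpose U ** M ** U) = F x p M"
    and \<nu>_\<kappa>: "\<nu> > 0" "1/2 < \<kappa>" "\<kappa> \<le> 1"
    and F_holder: "\<And>x p q M. x \<in> \<Omega> \<Longrightarrow> norm p = 1 \<Longrightarrow> norm q \<le> 1/2 \<Longrightarrow> M \<in> sym_matrices \<Longrightarrow>
        \<bar>F x (p + q) M - F x p M\<bar> \<le> \<nu> * norm q powr \<kappa> * norm M"
    and f_cont: "continuous_on I f"
    and N_or_convex: "CARD('n) \<le> 3 \<or>
        (CARD('n) > 3 \<and>
          ((\<forall>x\<in>\<Omega>. \<forall>p. p \<noteq> 0 \<longrightarrow> convex_on sym_matrices (F x p)) \<or>
           (\<forall>x\<in>\<Omega>. \<forall>p. p \<noteq> 0 \<longrightarrow> concave_on sym_matrices (F x p))))"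
    and v_radial: "\<And>x. x \<in> \<Omega> \<Longrightarrow> v x = u (norm x)"
    and v_sol: "viscosity_solution \<Omega> F f v"
  shows "\<exists>u'. C1_deriv_on I u u' \<and> locally_holder_on (1 / (1 + \<alpha>)) I u' \<and>
           (\<forall>r\<in>I. u' r \<noteq> 0 \<longrightarrow> C2_at_in I u r)"
proof -
  interpret elliptic_operator \<Omega> F \<alpha> a A
    by unfold_locales (fact constants F_cont F_hom F_ell)+
  obtain e :: "real^'n" where e: "norm e = 1" using vector_choose_size[of 1] by auto
  from dom consider
    (ball) R where "R > 0" "\<Omega> = ball 0 R" "I = {0..<R}" |
    (annulus) R1 R2 where "0 \<le> R1" "R1 < R2" "\<Omega> = {x. R1 < norm x \<and> norm x < R2}" "I = {R1<..<R2}"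
    unfolding radial_domain_def by blast
  then show ?thesis
  proof cases
    case annulus
    have "\<Omega> = norm -` {R1<..<R2}" using annulus by auto
    then have "open \<Omega>" by (simp add: open_vimage continuous_on_norm_id)
    then interpret radial_equation R1 R2 \<alpha> a "A * (real CARD('n) - 1)" "radial_op F e" f u
      using annulus e f_cont v_radial v_sol by (intro radial_equation_of_solution) auto
    show ?thesis
      using regularity_open_interval C2_at_in_interior[of _ I] annulus(4) by blast
  next
    case ball
    have "open \<Omega>" "0 \<in> \<Omega>" and f0: "continuous_on {0..<R} f" using ball f_cont by auto
    have I: "r *\<^sub>R e \<in> \<Omega>" if "r \<in> I" for r using that ball e by simp
    interpret radial_equation 0 R \<alpha> a "A * (real CARD('n) - 1)" "radial_op F e" f u
      using ball e v_radial v_sol continuous_on_subset[OF f_cont]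
      by (intro radial_equation_of_solution) (auto simp: subset_eq)
    have "continuous_on \<Omega> v" using v_sol by (simp add: viscosity_solution_def viscosity_subsolution_def)
    then have "continuous_on I (\<lambda>r. v (r *\<^sub>R e))"
      by (rule continuous_on_compose2) (use I in \<open>auto intro!: continuous_intros\<close>)
    moreover have "v (r *\<^sub>R e) = u r" if "r \<in> I" for r
      using v_radial[OF I[OF that]] e that ball by simp
    ultimately have u0: "continuous_on {0..<R} u" unfolding ball(3)[symmetric] by (rule continuous_on_eq)
    have sup: "viscosity_supersolution \<Omega> F f v"
      and sup': "viscosity_supersolution \<Omega> (dual_op F) (\<lambda>r. - f r) (\<lambda>x. - v x)"
      using v_sol viscosity_supersolution_dual by (auto simp: viscosity_solution_def)
    have no_cone: "\<not> (\<forall>\<^sub>F r in at_right 0. k * r \<le> u r - u 0)"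
      "\<not> (\<forall>\<^sub>F r in at_right 0. k * r \<le> u 0 - u r)" if "k > 0" for k
      using no_radial_cone[OF sup \<open>0 \<in> \<Omega>\<close> \<open>open \<Omega>\<close> v_radial that]
        elliptic_operator.no_radial_cone[OF dual sup' \<open>0 \<in> \<Omega>\<close> \<open>open \<Omega>\<close>, of "\<lambda>r. - u r" k] v_radial that
      by (auto simp: algebra_simps)
    define u' where "u' = (\<lambda>r. if r = 0 then 0 else deriv u r)"
    have "C1_deriv_on I u u'" "locally_holder_on (1 / (1 + \<alpha>)) I u'"
      unfolding u'_def ball(3)
      using regularity_with_origin[OF refl ball(1) u0 f0 no_cone] by blast+
    moreover have "C2_at_in I u r" if "r \<in> I" "u' r \<noteq> 0" for r
      using that ball(3) by (intro C2_at_in_interior) (auto simp: u'_def split: if_splits)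
    ultimately show ?thesis by blast
  qed
qed

end
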